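(* Let $V$ be a commutative generalized bijective variety in the language $L=\{f_1,\ldots,f_n\}$ of unary function symbols, and consider presentations with a single generator $a$ and a single identity $t(a)=t'(a)$. Let $F$ be the free structure in $V$ on $a$. If $F$ is infinite, then every elementary first-order $L$-sentence true in $F$ has limiting density $1$.
   Context: A variety is a class of structures, in a language with only function symbols and constants, axiomatized by universally quantified equations; its theory $T$ is the set of logical consequences of the axioms. Let $L=\{f_1,\ldots,f_n\}$ consist of unary function symbols. A variety $V$ with theory $T$ is generalized bijective if for each $i$, $T\vdash(\forall x,y)(f_i(x)=f_i(y)\to x=y)$ and $T\vdash(\forall y)(\exists x)\,f_i(x)=y$. It is commutative if $T\vdash(\forall x)\,f_i(f_j(x))=f_j(f_i(x))$ for all $i,j$. A presentation $a|R$ consists of a generator $a$ and one identity $R$ of the form $t(a)=t'(a)$, where $t,t'$ are arbitrary (possibly empty) finite strings of symbols from $f_1,\ldots,f_n$; identities are counted as ordered pairs $(t,t')$ of strings. The structure $\langle a|R\rangle$ is the member of $V$ generated by $a$ in which the equations between closed terms in $a$ that hold are exactly those that follow logically from $T\cup\{R\}$. The free structure on $a$ is the one given by the empty set of identities. The length of $t(a)=t'(a)$ is the total number of occurrences of function symbols in $t$ and $t'$. Let $P_s$ be the number of presentations whose identity has length at most $s$ and $P_s(\varphi)$ the number of these for which $\langle a|R\rangle\models\varphi$. The sentence $\varphi$ has limiting density $d$ if $\lim_{s\to\infty}P_s(\varphi)/P_s=d$. *)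

theory Defs
  imports Complex_Main "HOL-Library.Countable_Set"
begin

text \<open>
  First-order logic with equality over a language consisting of unary function symbols only.
  The language \<open>L = {f\<^sub>1, \<dots>, f\<^sub>n}\<close> is a finite type \<open>'f\<close> of symbols, so \<open>n = CARD('f)\<close>.
\<close>

datatype 'f trm = Var nat | App 'f "'f trm"

datatype 'f fm =
    Eq "'f trm" "'f trm"
  | Neg "'f fm"
  | Imp "'f fm" "'f fm"
  | Forall nat "'f fm"

abbreviation Exists :: "nat \<Rightarrow> 'f fm \<Rightarrow> 'f fm" where
  "Exists x \<phi> \<equiv> Neg (Forall x (Neg \<phi>))"

fun tvar :: "'f trm \<Rightarrow> nat" where
  "tvar (Var x) = x"
| "tvar (App i t) = tvar t"

fun fv :: "'f fm \<Rightarrow> nat set" where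
  "fv (Eq s t) = {tvar s, tvar t}"
| "fv (Neg \<phi>) = fv \<phi>"
| "fv (Imp \<phi> \<psi>) = fv \<phi> \<union> fv \<psi>"
| "fv (Forall x \<phi>) = fv \<phi> - {x}"

definition sentence :: "'f fm \<Rightarrow> bool" where
  "sentence \<phi> \<longleftrightarrow> fv \<phi> = {}"

record ('f, 'u) struct =
  universe :: "'u set"
  fn :: "'f \<Rightarrow> 'u \<Rightarrow> 'u"

definition is_struct :: "('f, 'u) struct \<Rightarrow> bool" where
  "is_struct M \<longleftrightarrow> universe M \<noteq> {} \<and> (\<forall>i. \<forall>x \<in> universe M. fn M i x \<in> universe M)"

fun tval :: "('f, 'u) struct \<Rightarrow> (nat \<Rightarrow> 'u) \<Rightarrow> 'f trm \<Rightarrow> 'u" where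
  "tval M \<beta> (Var x) = \<beta> x"
| "tval M \<beta> (App i t) = fn M i (tval M \<beta> t)"

fun sat :: "('f, 'u) struct \<Rightarrow> (nat \<Rightarrow> 'u) \<Rightarrow> 'f fm \<Rightarrow> bool" where
  "sat M \<beta> (Eq s t) \<longleftrightarrow> tval M \<beta> s = tval M \<beta> t"
| "sat M \<beta> (Neg \<phi>) \<longleftrightarrow> \<not> sat M \<beta> \<phi>"
| "sat M \<beta> (Imp \<phi> \<psi>) \<longleftrightarrow> (sat M \<beta> \<phi> \<longrightarrow> sat M \<beta> \<psi>)"
| "sat M \<beta> (Forall x \<phi>) \<longleftrightarrow> (\<forall>m \<in> universe M. sat M (\<beta>(x := m)) \<phi>)"

definition models :: "('f, 'u) struct \<Rightarrow> 'f fm \<Rightarrow> bool" (infix "\<Turnstile>" 50) where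
  "M \<Turnstile> \<phi> \<longleftrightarrow> (\<forall>\<beta>. range \<beta> \<subseteq> universe M \<longrightarrow> sat M \<beta> \<phi>)"

text \<open>
  Logical consequence. A definition cannot quantify over all types, so the structures range over
  those whose universe is a (finite or infinite) set of natural numbers. As the language is
  countable, this is consequence over all structures whatsoever, by the downward
  Loewenheim-Skolem theorem; see \<open>entails_any\<close> and \<open>consequence_any\<close> below.
\<close>

definition entails :: "'f fm set \<Rightarrow> 'f fm \<Rightarrow> bool" (infix "\<tturnstile>" 50) where
  "\<Gamma> \<tturnstile> \<phi> \<longleftrightarrow> (\<forall>M :: ('f, nat) struct. is_struct M \<and> (\<forall>\<psi> \<in> \<Gamma>. M \<Turnstile> \<psi>) \<longrightarrow> M \<Turnstile> \<phi>)"

text \<open>A variety is given by a set of universally quantified equations.\<close>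

definition universal_equation :: "'f fm \<Rightarrow> bool" where
  "universal_equation \<phi> \<longleftrightarrow> sentence \<phi> \<and> (\<exists>xs s t. \<phi> = foldr Forall xs (Eq s t))"

definition variety_axioms :: "'f fm set \<Rightarrow> bool" where
  "variety_axioms Ax \<longleftrightarrow> (\<forall>\<phi> \<in> Ax. universal_equation \<phi>)"

definition theory_of :: "'f fm set \<Rightarrow> 'f fm set" where
  "theory_of Ax = {\<phi>. sentence \<phi> \<and> Ax \<tturnstile> \<phi>}"

definition generalized_bijective :: "'f fm set \<Rightarrow> bool" where
  "generalized_bijective T \<longleftrightarrow> (\<forall>i.
     T \<tturnstile> Forall 0 (Forall 1 (Imp (Eq (App i (Var 0)) (App i (Var 1))) (Eq (Var 0) (Var 1)))) \<and>
     T \<tturnstile> Forall 1 (Exists 0 (Eq (App i (Var 0)) (Var 1))))"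

definition commutative_theory :: "'f fm set \<Rightarrow> bool" where
  "commutative_theory T \<longleftrightarrow> (\<forall>i j.
     T \<tturnstile> Forall 0 (Eq (App i (App j (Var 0))) (App j (App i (Var 0)))))"

text \<open>
  A string \<open>w = [g\<^sub>1, \<dots>, g\<^sub>k]\<close> stands for the closed term \<open>w(a) = g\<^sub>1(\<dots>(g\<^sub>k(a))\<dots>)\<close>, and a pair
  \<open>(t, t')\<close> of strings for the identity \<open>t(a) = t'(a)\<close>. A structure for the language \<open>L\<close> extended by
  the constant \<open>a\<close> is an \<open>L\<close>-structure \<open>M\<close> together with an element \<open>m\<close> of \<open>M\<close> interpreting \<open>a\<close>.
\<close>

definition word_val :: "('f, 'u) struct \<Rightarrow> 'f list \<Rightarrow> 'u \<Rightarrow> 'u" where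
  "word_val M w m = foldr (fn M) w m"

definition sat_ident :: "('f, 'u) struct \<Rightarrow> 'u \<Rightarrow> 'f list \<times> 'f list \<Rightarrow> bool" where
  "sat_ident M m r \<longleftrightarrow> word_val M (fst r) m = word_val M (snd r) m"

text \<open>The identity \<open>r\<close> follows logically from \<open>T \<union> R\<close>.\<close>

definition consequence ::
  "'f fm set \<Rightarrow> ('f list \<times> 'f list) set \<Rightarrow> 'f list \<times> 'f list \<Rightarrow> bool" where
  "consequence T R r \<longleftrightarrow> (\<forall>M :: ('f, nat) struct. \<forall>m \<in> universe M.
     is_struct M \<and> (\<forall>\<psi> \<in> T. M \<Turnstile> \<psi>) \<and> (\<forall>q \<in> R. sat_ident M m q) \<longrightarrow> sat_ident M m r)"

definition term_rel ::
  "'f fm set \<Rightarrow> ('f list \<times> 'f list) set \<Rightarrow> ('f list \<times> 'f list) set" where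
  "term_rel T R = {(u, v). consequence T R (u, v)}"

text \<open>
  The structure \<open>\<langle>a | R\<rangle>\<close>: closed terms in \<open>a\<close> modulo the equations following from \<open>T \<union> R\<close>.
  The generator \<open>a\<close> is the class of the empty string. On a class \<open>X\<close> the function \<open>f\<^sub>i\<close> takes as
  value the class of \<open>f\<^sub>i(w)\<close> for any \<open>w \<in> X\<close>.
\<close>

definition presented ::
  "'f fm set \<Rightarrow> ('f list \<times> 'f list) set \<Rightarrow> ('f, 'f list set) struct" where
  "presented T R = \<lparr> universe = UNIV // term_rel T R,
                     fn = (\<lambda>i X. term_rel T R `` ((\<lambda>w. i # w) ` X)) \<rparr>"

definition free_struct :: "'f fm set \<Rightarrow> ('f, 'f list set) struct" where
  "free_struct T = presented T {}"

definition idents_upto :: "nat \<Rightarrow> ('f list \<times> 'f list) set" where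
  "idents_upto s = {(t, t'). length t + length t' \<le> s}"

definition limiting_density :: "'f::finite fm set \<Rightarrow> 'f fm \<Rightarrow> real \<Rightarrow> bool" where
  "limiting_density T \<phi> d \<longleftrightarrow>
     (\<lambda>s. real (card {r \<in> idents_upto s. presented T {r} \<Turnstile> \<phi>}) /
          real (card (idents_upto s :: ('f list \<times> 'f list) set))) \<longlonglongrightarrow> d"


subsection \<open>Basic facts supporting the definitions\<close>

instance trm :: (countable) countable by countable_datatype
instance fm :: (countable) countable by countable_datatype

lemma finite_fv: "finite (fv \<phi>)"
  by (induction \<phi>) auto

lemma tval_cong: "\<beta> (tvar t) = \<gamma> (tvar t) \<Longrightarrow> tval M \<beta> t = tval M \<gamma> t"
  by (induction t) simp_all

lemma sat_cong: "\<forall>x \<in> fv \<phi>. \<beta> x = \<gamma> x \<Longrightarrow> sat M \<beta> \<phi> = sat M \<gamma> \<phi>"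
proof (induction \<phi> arbitrary: \<beta> \<gamma>)
  case (Eq s t)
  have "tval M \<beta> s = tval M \<gamma> s" "tval M \<beta> t = tval M \<gamma> t"
    by (rule tval_cong, use Eq in simp)+
  then show ?case by simp
next
  case (Neg \<phi>)
  show ?case using Neg.IH[of \<beta> \<gamma>] Neg.prems by simp
next
  case (Imp \<phi> \<psi>)
  show ?case using Imp.IH(1)[of \<beta> \<gamma>] Imp.IH(2)[of \<beta> \<gamma>] Imp.prems by simp
next
  case (Forall x \<phi>)
  have "sat M (\<beta>(x := m)) \<phi> = sat M (\<gamma>(x := m)) \<phi>" for m
    by (rule Forall.IH) (use Forall.prems in simp)
  then show ?case by simp
qed

lemma tval_in: "is_struct M \<Longrightarrow> range \<beta> \<subseteq> universe M \<Longrightarrow> tval M \<beta> t \<in> universe M"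
  by (induction t) (auto simp: is_struct_def)

lemma word_val_in: "is_struct M \<Longrightarrow> m \<in> universe M \<Longrightarrow> word_val M w m \<in> universe M"
  by (induction w) (auto simp: is_struct_def word_val_def)

text \<open>Isomorphic copies\<close>

lemma iso_copy:
  fixes M :: "('f, 'u) struct" and h :: "'u \<Rightarrow> 'v"
  assumes M: "is_struct M" and inj: "inj_on h (universe M)"
  obtains N :: "('f, 'v) struct" where "universe N = h ` universe M" "is_struct N"
    "\<And>\<beta> \<phi>. range \<beta> \<subseteq> universe M \<Longrightarrow> sat N (h \<circ> \<beta>) \<phi> = sat M \<beta> \<phi>"
    "\<And>\<phi>. N \<Turnstile> \<phi> \<longleftrightarrow> M \<Turnstile> \<phi>"
    "\<And>w m. m \<in> universe M \<Longrightarrow> word_val N w (h m) = h (word_val M w m)"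
proof
  define N where "N = \<lparr> universe = h ` universe M, fn = (\<lambda>i y. h (fn M i (inv_into (universe M) h y))) \<rparr>"
  show u: "universe N = h ` universe M" by (simp add: N_def)
  have fn: "fn N i (h x) = h (fn M i x)" if "x \<in> universe M" for i x
    using that inj by (simp add: N_def)
  show sN: "is_struct N"
    using M by (auto simp: is_struct_def u fn)
  have tv: "tval N (h \<circ> \<beta>) t = h (tval M \<beta> t)" if "range \<beta> \<subseteq> universe M" for \<beta> t
    by (induction t) (use that tval_in[OF M] fn in auto)
  show sat: "sat N (h \<circ> \<beta>) \<phi> = sat M \<beta> \<phi>" if "range \<beta> \<subseteq> universe M" for \<beta> \<phi>
    using that
  proof (induction \<phi> arbitrary: \<beta>)
    case (Eq s t)
    then show ?case
      using tval_in[OF M] inj_on_eq_iff[OF inj] tv by (simp del: o_apply)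
  next
    case (Forall x \<phi>)
    have "sat N ((h \<circ> \<beta>)(x := h m)) \<phi> = sat M (\<beta>(x := m)) \<phi>" if "m \<in> universe M" for m
    proof -
      have "(h \<circ> \<beta>)(x := h m) = h \<circ> (\<beta>(x := m))" by auto
      moreover have "range (\<beta>(x := m)) \<subseteq> universe M" using Forall.prems that by auto
      ultimately show ?thesis using Forall.IH by metis
    qed
    then show ?case by (simp add: u del: o_apply)
  qed auto
  show "N \<Turnstile> \<phi> \<longleftrightarrow> M \<Turnstile> \<phi>" for \<phi>
  proof
    assume *: "N \<Turnstile> \<phi>"
    show "M \<Turnstile> \<phi>"
      unfolding models_def
    proof (intro allI impI)
      fix \<beta> :: "nat \<Rightarrow> 'u" assume b: "range \<beta> \<subseteq> universe M"
      then have "range (h \<circ> \<beta>) \<subseteq> universe N" by (auto simp: u)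
      then show "sat M \<beta> \<phi>" using * sat[OF b] unfolding models_def by blast
    qed
  next
    assume *: "M \<Turnstile> \<phi>"
    show "N \<Turnstile> \<phi>"
      unfolding models_def
    proof (intro allI impI)
      fix \<gamma> :: "nat \<Rightarrow> 'v" assume g: "range \<gamma> \<subseteq> universe N"
      define \<beta> where "\<beta> = inv_into (universe M) h \<circ> \<gamma>"
      have gx: "\<gamma> x \<in> h ` universe M" for x using g u by auto
      have "\<gamma> = h \<circ> \<beta>" using gx by (auto simp: \<beta>_def f_inv_into_f)
      moreover have "range \<beta> \<subseteq> universe M"
        using gx by (auto simp: \<beta>_def inv_into_into)
      ultimately show "sat N \<gamma> \<phi>" using * sat by (auto simp: models_def)
    qed
  qed
  show "word_val N w (h m) = h (word_val M w m)" if "m \<in> universe M" for w m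
    using word_val_in[OF M that] by (induction w) (auto simp: word_val_def fn)
qed

text \<open>Downward Loewenheim-Skolem\<close>

lemma loewenheim_skolem:
  fixes M :: "('f::countable, 'u) struct"
  assumes M: "is_struct M" and m: "m \<in> universe M"
  obtains U where "countable U" "m \<in> U" "U \<subseteq> universe M" "is_struct (M\<lparr>universe := U\<rparr>)"
    "\<And>\<beta> \<phi>. range \<beta> \<subseteq> U \<Longrightarrow> sat (M\<lparr>universe := U\<rparr>) \<beta> \<phi> = sat M \<beta> \<phi>"
proof -
  define as where "as l = (\<lambda>k. if k < length l then l ! k else m)" for l
  define wit where "wit \<phi> x l =
    (SOME b. b \<in> universe M \<and> ((\<exists>c \<in> universe M. \<not> sat M ((as l)(x := c)) \<phi>) \<longrightarrow>
                             \<not> sat M ((as l)(x := b)) \<phi>))" for \<phi> and x :: nat and l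
  have wit: "wit \<phi> x l \<in> universe M \<and> ((\<exists>c \<in> universe M. \<not> sat M ((as l)(x := c)) \<phi>) \<longrightarrow>
                             \<not> sat M ((as l)(x := wit \<phi> x l)) \<phi>)" for \<phi> x l
    unfolding wit_def by (rule someI_ex) (use m in blast)
  define step where "step S = S \<union> (\<lambda>(i, x). fn M i x) ` (UNIV \<times> S)
      \<union> (\<lambda>(\<phi>, x, l). wit \<phi> x l) ` (UNIV \<times> UNIV \<times> lists S)" for S
  define U where "U = (\<Union>k. (step ^^ k) {m})"
  have cs: "countable ((step ^^ k) {m})" for k
    by (induction k) (auto simp: step_def)
  have inM: "(step ^^ k) {m} \<subseteq> universe M" for k
    by (induction k) (use m M wit in \<open>auto simp: step_def is_struct_def\<close>)
  have mono: "(step ^^ k) {m} \<subseteq> (step ^^ k') {m}" if "k \<le> k'" for k k'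
    using that by (induction rule: dec_induct) (auto simp: step_def)
  have fnU: "fn M i x \<in> U" if x: "x \<in> U" for i x
  proof -
    obtain k where "x \<in> (step ^^ k) {m}" using x unfolding U_def by blast
    then have "fn M i x \<in> (step ^^ Suc k) {m}" by (auto simp: step_def)
    then show ?thesis unfolding U_def by blast
  qed
  have listU: "\<exists>k. l \<in> lists ((step ^^ k) {m})" if "l \<in> lists U" for l
    using that
  proof (induction l)
    case (Cons a l)
    then obtain k k' where "a \<in> (step ^^ k) {m}" "l \<in> lists ((step ^^ k') {m})"
      by (auto simp: U_def)
    then have "a # l \<in> lists ((step ^^ max k k') {m})"
      using mono[of k "max k k'"] mono[of k' "max k k'"] by auto
    then show ?case by blast
  qed auto
  have witU: "wit \<phi> x l \<in> U" if l: "l \<in> lists U" for \<phi> x l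
  proof -
    obtain k where "l \<in> lists ((step ^^ k) {m})" using listU[OF l] by blast
    then have "(\<phi>, x, l) \<in> UNIV \<times> UNIV \<times> lists ((step ^^ k) {m})" by simp
    then have "wit \<phi> x l \<in> (\<lambda>(\<phi>, x, l). wit \<phi> x l) ` (UNIV \<times> UNIV \<times> lists ((step ^^ k) {m}))"
      by (metis (mono_tags, lifting) case_prod_conv image_eqI)
    then have "wit \<phi> x l \<in> (step ^^ Suc k) {m}" by (simp add: step_def)
    then show ?thesis unfolding U_def by blast
  qed
  have UM: "U \<subseteq> universe M" using inM by (auto simp: U_def)
  have mU: "m \<in> U" unfolding U_def by (rule UN_I[of 0]) auto
  let ?N = "M\<lparr>universe := U\<rparr>"
  have tv: "tval ?N \<beta> t = tval M \<beta> t" for \<beta> t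
    by (induction t) auto
  have sat: "sat ?N \<beta> \<phi> = sat M \<beta> \<phi>" if "range \<beta> \<subseteq> U" for \<beta> \<phi>
    using that
  proof (induction \<phi> arbitrary: \<beta>)
    case (Forall x \<phi>)
    have IH: "sat ?N (\<beta>(x := b)) \<phi> = sat M (\<beta>(x := b)) \<phi>" if "b \<in> U" for b
      by (rule Forall.IH) (use Forall.prems that in auto)
    have "\<forall>c \<in> universe M. sat M (\<beta>(x := c)) \<phi>" if *: "\<forall>b \<in> U. sat M (\<beta>(x := b)) \<phi>"
    proof -
      obtain n where n: "\<forall>k \<in> fv \<phi>. k < n"
        using finite_fv[of \<phi>] finite_nat_set_iff_bounded by blast
      define l where "l = map \<beta> [0..<n]"
      have c: "sat M ((as l)(x := c)) \<phi> = sat M (\<beta>(x := c)) \<phi>" for c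
        by (rule sat_cong) (use n in \<open>auto simp: as_def l_def\<close>)
      have "l \<in> lists U" using Forall.prems by (force simp: l_def)
      then have "sat M (\<beta>(x := wit \<phi> x l)) \<phi>" using witU * by blast
      then show ?thesis using wit[of \<phi> x l] c by blast
    qed
    then show ?case using UM IH by auto
  qed (auto simp: tv)
  show thesis
  proof (rule that[of U])
    show "countable U" using cs by (auto simp: U_def)
    show "is_struct ?N" using mU fnU by (auto simp: is_struct_def)
  qed (use mU UM sat in auto)
qed

lemma models_sentence:
  assumes "sentence \<phi>" "range \<beta> \<subseteq> universe M"
  shows "M \<Turnstile> \<phi> \<longleftrightarrow> sat M \<beta> \<phi>"
proof -
  have "sat M \<gamma> \<phi> = sat M \<beta> \<phi>" for \<gamma>
    by (rule sat_cong) (use assms(1) in \<open>simp add: sentence_def\<close>)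
  then show ?thesis using assms(2) unfolding models_def by blast
qed

lemma countable_copy:
  fixes M :: "('f::countable, 'u) struct"
  assumes M: "is_struct M" and m: "m \<in> universe M"
  obtains N :: "('f, nat) struct" and n where "is_struct N" "n \<in> universe N"
    "\<And>\<phi>. sentence \<phi> \<Longrightarrow> N \<Turnstile> \<phi> \<longleftrightarrow> M \<Turnstile> \<phi>"
    "\<And>r. sat_ident N n r \<longleftrightarrow> sat_ident M m r"
proof -
  obtain U where U: "countable U" "m \<in> U" "U \<subseteq> universe M" "is_struct (M\<lparr>universe := U\<rparr>)"
    "\<And>\<beta> \<phi>. range \<beta> \<subseteq> U \<Longrightarrow> sat (M\<lparr>universe := U\<rparr>) \<beta> \<phi> = sat M \<beta> \<phi>"
    using loewenheim_skolem[OF M m] by blast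
  let ?K = "M\<lparr>universe := U\<rparr>"
  have inj: "inj_on (to_nat_on U) (universe ?K)" using U(1) by (simp add: inj_on_to_nat_on)
  obtain N :: "('f, nat) struct" where N: "universe N = to_nat_on U ` universe ?K" "is_struct N"
    "\<And>\<phi>. N \<Turnstile> \<phi> \<longleftrightarrow> ?K \<Turnstile> \<phi>"
    "\<And>w b. b \<in> universe ?K \<Longrightarrow> word_val N w (to_nat_on U b) = to_nat_on U (word_val ?K w b)"
    using iso_copy[OF U(4) inj] by metis
  have K: "?K \<Turnstile> \<phi> \<longleftrightarrow> M \<Turnstile> \<phi>" if "sentence \<phi>" for \<phi>
  proof -
    have "range (\<lambda>_. m) \<subseteq> U" "range (\<lambda>_. m) \<subseteq> universe M" "range (\<lambda>_. m) \<subseteq> universe ?K"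
      using U(2) m by auto
    then show ?thesis using models_sentence[OF that] U(5) by metis
  qed
  show thesis
  proof (rule that[of N "to_nat_on U m"])
    show "sat_ident N (to_nat_on U m) r \<longleftrightarrow> sat_ident M m r" for r
    proof -
      have "word_val ?K w m = word_val M w m" for w by (simp add: word_val_def)
      moreover have "word_val ?K w m \<in> U" for w
        using word_val_in[OF U(4), of m w] U(2) by simp
      ultimately show ?thesis
        using N(4)[of m] U(2) inj_on_eq_iff[OF inj] by (simp add: sat_ident_def)
    qed
    show "is_struct N" by (rule N(2))
    show "to_nat_on U m \<in> universe N" using U(2) by (simp add: N(1))
    show "N \<Turnstile> \<phi> \<longleftrightarrow> M \<Turnstile> \<phi>" if "sentence \<phi>" for \<phi>
      using K[OF that] N(3)[of \<phi>] by (rule trans[rotated])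
  qed
qed

theorem entails_any:
  fixes M :: "('f::countable, 'u) struct"
  assumes "\<Gamma> \<tturnstile> \<phi>" "\<And>\<psi>. \<psi> \<in> \<Gamma> \<Longrightarrow> sentence \<psi>" "sentence \<phi>"
    and "is_struct M" "\<And>\<psi>. \<psi> \<in> \<Gamma> \<Longrightarrow> M \<Turnstile> \<psi>"
  shows "M \<Turnstile> \<phi>"
proof -
  obtain m where "m \<in> universe M" using assms(4) by (auto simp: is_struct_def)
  then obtain N :: "('f, nat) struct" where N: "is_struct N"
    "\<And>\<phi>. sentence \<phi> \<Longrightarrow> N \<Turnstile> \<phi> \<longleftrightarrow> M \<Turnstile> \<phi>"
    using countable_copy[OF assms(4)] by blast
  have "\<forall>\<psi> \<in> \<Gamma>. N \<Turnstile> \<psi>" using assms(2,5) N(2) by blast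
  then have "N \<Turnstile> \<phi>" using assms(1) N(1) unfolding entails_def by blast
  then show ?thesis using N(2) assms(3) by blast
qed

theorem consequence_any:
  fixes M :: "('f::countable, 'u) struct"
  assumes "consequence T R r" "\<And>\<psi>. \<psi> \<in> T \<Longrightarrow> sentence \<psi>"
    and "is_struct M" "m \<in> universe M" "\<And>\<psi>. \<psi> \<in> T \<Longrightarrow> M \<Turnstile> \<psi>" "\<And>q. q \<in> R \<Longrightarrow> sat_ident M m q"
  shows "sat_ident M m r"
proof -
  obtain N :: "('f, nat) struct" and n where N: "is_struct N" "n \<in> universe N"
    "\<And>\<phi>. sentence \<phi> \<Longrightarrow> N \<Turnstile> \<phi> \<longleftrightarrow> M \<Turnstile> \<phi>"
    "\<And>r. sat_ident N n r \<longleftrightarrow> sat_ident M m r"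
    using countable_copy[OF assms(3,4)] by blast
  have "\<forall>\<psi> \<in> T. N \<Turnstile> \<psi>" "\<forall>q \<in> R. sat_ident N n q"
    using assms(2,5,6) N(3,4) by blast+
  then have "sat_ident N n r"
    using assms(1) N(1,2) unfolding consequence_def by blast
  then show ?thesis using N(4) by blast
qed

text \<open>
  The structure \<open>\<langle>a | R\<rangle>\<close> is generated by \<open>a\<close>, the equations between closed terms holding in it are
  the consequences of \<open>T \<union> R\<close>, and it is a member of the variety.
\<close>

lemma equiv_term_rel: "equiv UNIV (term_rel T R)"
proof (rule equivI)
  show "term_rel T R \<subseteq> UNIV \<times> UNIV" by simp
  show "refl_on UNIV (term_rel T R)"
    by (simp add: refl_on_def term_rel_def consequence_def sat_ident_def)
  show "sym (term_rel T R)"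
    by (simp add: sym_def term_rel_def consequence_def sat_ident_def)
  show "trans (term_rel T R)"
    by (simp add: trans_def term_rel_def consequence_def sat_ident_def)
qed

lemma term_rel_Cons: "(u, v) \<in> term_rel T R \<Longrightarrow> (i # u, i # v) \<in> term_rel T R"
  by (simp add: term_rel_def consequence_def sat_ident_def word_val_def)

lemma fn_presented: "fn (presented T R) i (term_rel T R `` {w}) = term_rel T R `` {i # w}"
proof -
  have e: "(v, y) \<in> term_rel T R \<Longrightarrow> (u, v) \<in> term_rel T R \<Longrightarrow> (u, y) \<in> term_rel T R"
    and r: "(u, u) \<in> term_rel T R" for u v y
    using equiv_term_rel[of T R] unfolding equiv_def trans_def refl_on_def by blast+
  have "y \<in> term_rel T R `` ((\<lambda>w. i # w) ` (term_rel T R `` {w})) \<longleftrightarrow> (i # w, y) \<in> term_rel T R" for y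
  proof
    assume "y \<in> term_rel T R `` ((\<lambda>w. i # w) ` (term_rel T R `` {w}))"
    then obtain v where "(w, v) \<in> term_rel T R" "(i # v, y) \<in> term_rel T R" by blast
    then show "(i # w, y) \<in> term_rel T R" by (metis e term_rel_Cons)
  next
    assume "(i # w, y) \<in> term_rel T R"
    then show "y \<in> term_rel T R `` ((\<lambda>w. i # w) ` (term_rel T R `` {w}))" using r[of w] by blast
  qed
  then show ?thesis by (simp add: presented_def set_eq_iff)
qed

lemma word_val_presented:
  "word_val (presented T R) u (term_rel T R `` {[]}) = term_rel T R `` {u}"
  by (induction u) (auto simp: word_val_def fn_presented)

theorem presented_generated:
  "universe (presented T R) = range (\<lambda>w. word_val (presented T R) w (term_rel T R `` {[]}))"
  unfolding word_val_presented by (auto simp: presented_def quotient_def)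

theorem presented_equations:
  "sat_ident (presented T R) (term_rel T R `` {[]}) r \<longleftrightarrow> consequence T R r"
proof -
  have "sat_ident (presented T R) (term_rel T R `` {[]}) r \<longleftrightarrow> r \<in> term_rel T R"
    using eq_equiv_class_iff[OF equiv_term_rel, of "fst r" "snd r" T R]
    by (simp add: sat_ident_def word_val_presented)
  then show ?thesis by (cases r) (simp add: term_rel_def)
qed

theorem is_struct_presented: "is_struct (presented T R)"
  unfolding is_struct_def
proof (intro conjI allI ballI)
  show "universe (presented T R) \<noteq> {}" by (simp add: presented_generated)
  fix i X assume "X \<in> universe (presented T R)"
  then obtain w where "X = term_rel T R `` {w}" by (auto simp: presented_def quotient_def)
  then show "fn (presented T R) i X \<in> universe (presented T R)"
    by (auto simp: fn_presented) (auto simp: presented_def quotient_def)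
qed

lemma models_foldr_All:
  fixes M :: "('f, 'a) struct"
  shows "M \<Turnstile> foldr Forall xs \<phi> \<longleftrightarrow> M \<Turnstile> \<phi>"
proof -
  have "M \<Turnstile> Forall x \<psi> \<longleftrightarrow> M \<Turnstile> \<psi>" for x \<psi>
  proof
    assume *: "M \<Turnstile> Forall x \<psi>"
    show "M \<Turnstile> \<psi>"
      unfolding models_def
    proof (intro allI impI)
      fix \<beta> :: "nat \<Rightarrow> 'a" assume b: "range \<beta> \<subseteq> universe M"
      then have "sat M (\<beta>(x := \<beta> x)) \<psi>" using * by (auto simp: models_def simp del: fun_upd_triv)
      then show "sat M \<beta> \<psi>" by simp
    qed
  qed (simp add: models_def image_subset_iff)
  then show ?thesis by (induction xs) simp_all
qed

fun tword :: "'f trm \<Rightarrow> 'f list" where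
  "tword (Var x) = []"
| "tword (App i t) = i # tword t"

lemma tval_word: "tval M \<beta> t = word_val M (tword t) (\<beta> (tvar t))"
  by (induction t) (auto simp: word_val_def)

theorem presented_in_variety:
  fixes Ax :: "'f::countable fm set"
  assumes Ax: "variety_axioms Ax" and \<phi>: "\<phi> \<in> theory_of Ax"
  shows "presented (theory_of Ax) R \<Turnstile> \<phi>"
proof (rule entails_any)
  show "Ax \<tturnstile> \<phi>" "sentence \<phi>" using \<phi> by (auto simp: theory_of_def)
  show "sentence \<psi>" if "\<psi> \<in> Ax" for \<psi>
    using that Ax by (auto simp: variety_axioms_def universal_equation_def)
  let ?T = "theory_of Ax"
  let ?P = "presented ?T R"
  let ?c = "\<lambda>w. term_rel ?T R `` {w}"
  show "is_struct ?P" by (rule is_struct_presented)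
  show "?P \<Turnstile> \<psi>" if psi: "\<psi> \<in> Ax" for \<psi>
  proof -
    obtain xs s t where st: "\<psi> = foldr Forall xs (Eq s t)" "sentence \<psi>"
      using psi Ax by (auto simp: variety_axioms_def universal_equation_def)
    have psiT: "\<psi> \<in> ?T" using psi st(2) by (auto simp: theory_of_def entails_def)
    have wc: "word_val ?P u (?c w) = ?c (u @ w)" for u w
      by (induction u) (auto simp: word_val_def fn_presented)
    have "sat ?P \<beta> (Eq s t)" if b: "range \<beta> \<subseteq> universe ?P" for \<beta>
    proof -
      have "\<forall>x. \<exists>w. \<beta> x = ?c w" using b by (auto simp: presented_def quotient_def)
      then obtain \<rho> where \<rho>: "\<And>x. \<beta> x = ?c (\<rho> x)" by metis
      have "consequence ?T R (tword s @ \<rho> (tvar s), tword t @ \<rho> (tvar t))"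
        unfolding consequence_def
      proof (intro allI ballI impI)
        fix M :: "('f, nat) struct" and m
        assume m: "m \<in> universe M" and
          *: "is_struct M \<and> (\<forall>\<psi>\<in>?T. M \<Turnstile> \<psi>) \<and> (\<forall>q\<in>R. sat_ident M m q)"
        have "M \<Turnstile> Eq s t"
          using models_foldr_All[of M xs "Eq s t"] st psiT * by blast
        moreover have "range (\<lambda>x. word_val M (\<rho> x) m) \<subseteq> universe M"
          using word_val_in[of M m] m * by auto
        ultimately have "sat M (\<lambda>x. word_val M (\<rho> x) m) (Eq s t)"
          by (auto simp: models_def)
        then show "sat_ident M m (tword s @ \<rho> (tvar s), tword t @ \<rho> (tvar t))"
          by (simp add: tval_word sat_ident_def) (simp add: word_val_def)
      qed
      then have "?c (tword s @ \<rho> (tvar s)) = ?c (tword t @ \<rho> (tvar t))"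
        by (intro equiv_class_eq[OF equiv_term_rel]) (simp add: term_rel_def)
      then show ?thesis by (simp add: tval_word \<rho> wc)
    qed
    then have "?P \<Turnstile> Eq s t" by (auto simp: models_def)
    then show ?thesis using models_foldr_All st(1) by blast
  qed
qed

end

(*
  In the variety, the closed terms in a form a finitely generated abelian group G, in which every
  element is represented by a positive word, F is G acting on itself, and <a | t = t'> is
  G / <t - t'>. All points of such structures look alike, so an Ehrenfeucht-Fraisse argument shows
  that a sentence can distinguish G from G / <g> only if <g> meets a fixed finite set B of nonzero
  elements (the size of the quotient is then controlled as well, because G is infinite).
  For fixed b in B there is a nonconstant homomorphism chi from G to the integers such that b in <g>
  bounds |chi g|: if b has infinite order, choose chi with chi b nonzero, so that chi g divides it;
  if b is torsion, so is g, and any chi works with bound 0. Finally, chi t - chi t' is a sum of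
  about s steps of a nondegenerate walk, and takes any fixed value with probability tending to 0.
*)
theory Submission
  imports Defs "HOL-Library.Multiset" "HOL-Analysis.Cartesian_Space"
begin

subsection \<open>Transfer between structures with commuting bijections\<close>

text \<open>The language has no symbols for inverses. They come from surjectivity: \<open>a\<close>
  is a value of \<open>f_i\<close> in the free structure, whose elements are all words in
  \<open>a\<close>, so some word undoes \<open>f_i\<close>. The same fact makes the walk
  nondegenerate. If all symbols had equal weight, the weight of a word would be its length times a
  constant, and a nonempty word provably equal to the empty one forces that constant to be 0. So a
  nonzero weight tells two symbols apart, and the weights of words of one fixed length are already
  spread out. Each pair of lengths can therefore be bounded separately, and one long side is enough.
  Group elements are kept as multisets of symbols up to provable equality, and relations are written
  without subtraction, with natural multiples on both sides. The finite set of the overview is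
  finite because a sentence inspects only words of bounded length: each quantifier doubles the
  length that matters.\<close>

definition commuting_bijections :: "('f, 'u) struct \<Rightarrow> bool" where
  "commuting_bijections M \<longleftrightarrow> is_struct M \<and>
     (\<forall>i. bij_betw (fn M i) (universe M) (universe M)) \<and>
     (\<forall>i j. \<forall>x \<in> universe M. fn M i (fn M j x) = fn M j (fn M i x))"

lemma word_val_append: "word_val M (u @ v) x = word_val M u (word_val M v x)"
  by (simp add: word_val_def)

lemma word_val_bij:
  assumes "commuting_bijections M"
  shows "bij_betw (word_val M w) (universe M) (universe M)"
proof (induction w)
  case Nil
  have "word_val M [] = id" by (auto simp: word_val_def)
  then show ?case by (metis bij_betw_id)
next
  case (Cons i w)
  have "word_val M (i # w) = fn M i \<circ> word_val M w" by (auto simp: word_val_def)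
  then show ?case
    using bij_betw_trans[OF Cons, of "fn M i" "universe M"] assms
    unfolding commuting_bijections_def by metis
qed

lemma word_val_inject:
  assumes "commuting_bijections M" "x \<in> universe M" "y \<in> universe M"
  shows "word_val M w x = word_val M w y \<longleftrightarrow> x = y"
  using word_val_bij[OF assms(1), of w] assms(2,3) by (meson bij_betw_imp_inj_on inj_on_eq_iff)

lemma word_val_universe:
  assumes "commuting_bijections M" "x \<in> universe M"
  shows "word_val M w x \<in> universe M"
  using assms word_val_in by (auto simp: commuting_bijections_def)

lemma word_val_commute:
  assumes M: "commuting_bijections M" and x: "x \<in> universe M"
  shows "word_val M u (word_val M v x) = word_val M v (word_val M u x)"
proof -
  have fn_word: "fn M i (word_val M w y) = word_val M w (fn M i y)" if "y \<in> universe M" for i w y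
  proof (induction w)
    case (Cons j w)
    have "fn M i (word_val M (j # w) y) = fn M j (fn M i (word_val M w y))"
      using M word_val_universe[OF M that, of w]
      by (simp add: word_val_def commuting_bijections_def)
    then show ?case using Cons by (simp add: word_val_def)
  qed (simp add: word_val_def)
  show ?thesis
  proof (induction u)
    case (Cons i u)
    have "word_val M (i # u) (word_val M v x) = fn M i (word_val M v (word_val M u x))"
      using Cons by (simp add: word_val_def)
    also have "\<dots> = word_val M v (fn M i (word_val M u x))"
      by (rule fn_word) (rule word_val_universe[OF M x])
    finally show ?case by (simp add: word_val_def)
  qed (simp add: word_val_def)
qed

text \<open>Applying the injective \<open>v\<close> to both sides and commuting it past
  \<open>p\<close> turns \<open>v b\<close> into \<open>u y\<close>. A question about a new element
  \<open>b\<close> becomes one about old elements, at the price of words up to twice as long; this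
  is the source of the doubled radius.\<close>

lemma word_val_tie:
  assumes M: "commuting_bijections M" and U: "b \<in> universe M" "y \<in> universe M" "z \<in> universe M"
    and tie: "word_val M v b = word_val M u y"
  shows "word_val M p b = word_val M q z \<longleftrightarrow> word_val M (p @ u) y = word_val M (v @ q) z"
proof -
  have "word_val M p b = word_val M q z \<longleftrightarrow>
      word_val M v (word_val M p b) = word_val M v (word_val M q z)"
    using word_val_inject[OF M] word_val_universe[OF M] U by metis
  also have "word_val M v (word_val M p b) = word_val M p (word_val M u y)"
    using word_val_commute[OF M U(1), of v p] tie by simp
  finally show ?thesis by (simp add: word_val_append)
qed

section \<open>Back and forth with words of bounded length\<close>

definition similar ::
  "nat \<Rightarrow> nat set \<Rightarrow> ('f, 'u) struct \<Rightarrow> (nat \<Rightarrow> 'u) \<Rightarrow> ('f, 'v) struct \<Rightarrow> (nat \<Rightarrow> 'v) \<Rightarrow> bool" where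
  "similar r V M \<beta> N \<gamma> \<longleftrightarrow> (\<forall>x \<in> V. \<forall>y \<in> V. \<forall>u v. length u \<le> r \<longrightarrow> length v \<le> r \<longrightarrow>
     (word_val M u (\<beta> x) = word_val M v (\<beta> y) \<longleftrightarrow> word_val N u (\<gamma> x) = word_val N v (\<gamma> y)))"

text \<open>The points on the two sides range independently, so validity of a short equation is also
  uniform within each structure. This settles how a newly chosen element compares with itself,
  wherever it lies.\<close>

definition agree :: "nat \<Rightarrow> ('f, 'u) struct \<Rightarrow> ('f, 'v) struct \<Rightarrow> bool" where
  "agree r M N \<longleftrightarrow> (\<forall>a \<in> universe M. \<forall>b \<in> universe N. \<forall>u v. length u \<le> r \<longrightarrow> length v \<le> r \<longrightarrow>
     (word_val M u a = word_val M v a \<longleftrightarrow> word_val N u b = word_val N v b))"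

text \<open>The disjunction is there because \<open>card\<close> is 0 on infinite sets.\<close>

definition larger_than :: "nat \<Rightarrow> ('f, 'u) struct \<Rightarrow> bool" where
  "larger_than k M \<longleftrightarrow> infinite (universe M) \<or> k < card (universe M)"

lemma similar_sym: "similar r V M \<beta> N \<gamma> \<Longrightarrow> similar r V N \<gamma> M \<beta>"
  by (simp add: similar_def)

lemma similar_mono: "similar r V M \<beta> N \<gamma> \<Longrightarrow> r' \<le> r \<Longrightarrow> V' \<subseteq> V \<Longrightarrow> similar r' V' M \<beta> N \<gamma>"
  unfolding similar_def by (meson order_trans subsetD)

lemma agree_sym: "agree r M N \<Longrightarrow> agree r N M"
  by (simp add: agree_def)

lemma agree_mono: "agree r M N \<Longrightarrow> r' \<le> r \<Longrightarrow> agree r' M N"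
  unfolding agree_def by (meson order_trans)

lemma larger_than_mono: "larger_than k M \<Longrightarrow> k' \<le> k \<Longrightarrow> larger_than k' M"
  by (auto simp: larger_than_def)

lemma finite_words: "finite {w :: 'f::finite list. length w \<le> r}"
  using finite_lists_length_le[of "UNIV :: 'f set" r] by simp

text \<open>
  The new element either is tied to an old one by words of length at most \<open>r\<close>, and then the tie
  determines its partner, or it is far from all old elements, and then so are almost all elements
  of the other structure.
\<close>

lemma similar_extend:
  fixes M :: "('f::finite, 'u) struct" and N :: "('f, 'v) struct"
  assumes M: "commuting_bijections M" and N: "commuting_bijections N"
    and agree: "agree r M N" and V: "finite V" "x \<notin> V"
    and large: "larger_than (card V * (card {w :: 'f list. length w \<le> r})\<^sup>2) N"
    and sim: "similar (2 * r) V M \<beta> N \<gamma>"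
    and \<beta>: "\<And>y. \<beta> y \<in> universe M" and \<gamma>: "\<And>y. \<gamma> y \<in> universe N"
    and b: "b \<in> universe M"
  obtains c where "c \<in> universe N" "similar r (insert x V) M (\<beta>(x := b)) N (\<gamma>(x := c))"
proof -
  let ?W = "{w :: 'f list. length w \<le> r}"
  note found = that
  \<comment> \<open>Only ties between the new element and old ones are left to arrange: pairs of old
    elements are covered by \<open>sim\<close>, the new element against itself by
    \<open>agree\<close>.\<close>
  have main: thesis if c: "c \<in> universe N" and tie: "\<And>y u v. y \<in> V \<Longrightarrow> u \<in> ?W \<Longrightarrow> v \<in> ?W \<Longrightarrow>
      word_val M u b = word_val M v (\<beta> y) \<longleftrightarrow> word_val N u c = word_val N v (\<gamma> y)" for c
  proof (rule found[OF c])
    have old: "word_val M u (\<beta> y) = word_val M v (\<beta> z) \<longleftrightarrow> word_val N u (\<gamma> y) = word_val N v (\<gamma> z)"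
      if "y \<in> V" "z \<in> V" "length u \<le> r" "length v \<le> r" for y z u v
      using similar_mono[OF sim _ order_refl, of r] that unfolding similar_def by simp
    have self: "word_val M u b = word_val M v b \<longleftrightarrow> word_val N u c = word_val N v c"
      if "length u \<le> r" "length v \<le> r" for u v
      using agree b c that unfolding agree_def by blast
    have tie': "word_val M v (\<beta> y) = word_val M u b \<longleftrightarrow> word_val N v (\<gamma> y) = word_val N u c"
      if "y \<in> V" "length u \<le> r" "length v \<le> r" for y u v
      using tie[of y u v] that by auto
    show "similar r (insert x V) M (\<beta>(x := b)) N (\<gamma>(x := c))"
      unfolding similar_def
    proof (intro ballI allI impI)
      fix y z u v assume *: "y \<in> insert x V" "z \<in> insert x V" "length (u :: 'f list) \<le> r" "length (v :: 'f list) \<le> r"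
      show "word_val M u ((\<beta>(x := b)) y) = word_val M v ((\<beta>(x := b)) z) \<longleftrightarrow>
        word_val N u ((\<gamma>(x := c)) y) = word_val N v ((\<gamma>(x := c)) z)"
        using * V(2) self[of u v] old[of y z u v] tie[of z u v] tie'[of y v u]
        by (cases "y = x"; cases "z = x") auto
    qed
  qed
  show thesis
  proof (cases "\<exists>y \<in> V. \<exists>u \<in> ?W. \<exists>v \<in> ?W. word_val M v b = word_val M u (\<beta> y)")
    case True
    then obtain y u v where y: "y \<in> V" and uv: "length u \<le> r" "length v \<le> r"
      and b_tie: "word_val M v b = word_val M u (\<beta> y)" by blast
    obtain c where c: "c \<in> universe N" and c_tie: "word_val N v c = word_val N u (\<gamma> y)"
      using word_val_bij[OF N, of v] word_val_universe[OF N \<gamma>, of u y]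
      by (metis (no_types, opaque_lifting) bij_betw_imp_surj_on imageE)
    show thesis
    proof (rule main[OF c])
      fix z p q assume z: "z \<in> V" and pq: "p \<in> ?W" "q \<in> ?W"
      have "word_val M p b = word_val M q (\<beta> z) \<longleftrightarrow> word_val M (p @ u) (\<beta> y) = word_val M (v @ q) (\<beta> z)"
        by (rule word_val_tie[OF M b \<beta> \<beta> b_tie])
      also have "\<dots> \<longleftrightarrow> word_val N (p @ u) (\<gamma> y) = word_val N (v @ q) (\<gamma> z)"
        using sim y z uv pq unfolding similar_def by simp
      also have "\<dots> \<longleftrightarrow> word_val N p c = word_val N q (\<gamma> z)"
        by (rule word_val_tie[OF N c \<gamma> \<gamma> c_tie, symmetric])
      finally show "word_val M p b = word_val M q (\<beta> z) \<longleftrightarrow> word_val N p c = word_val N q (\<gamma> z)" .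
    qed
  next
    case False
    \<comment> \<open>\<open>g (y, u, v)\<close> is the unique solution \<open>c\<close> of
      \<open>v c = u (\<gamma> y)\<close>. Its values are the elements to avoid, and counting the
      triples gives the bound in \<open>large\<close>.\<close>
    define g where "g = (\<lambda>(y, u, v). inv_into (universe N) (word_val N v) (word_val N u (\<gamma> y)))"
    let ?X = "g ` (V \<times> ?W \<times> ?W)"
    have fin: "finite (V \<times> ?W \<times> ?W)" using V(1) finite_words by (intro finite_cartesian_product)
    have "card ?X \<le> card V * (card ?W)\<^sup>2"
      using card_image_le[OF fin, of g] by (simp add: card_cartesian_product power2_eq_square)
    then have "\<not> universe N \<subseteq> ?X"
      using large fin card_mono[of ?X "universe N"] finite_subset[of "universe N" ?X]
      unfolding larger_than_def by fastforce
    then obtain c where c: "c \<in> universe N" "c \<notin> ?X" by blast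
    have far: "word_val N v c \<noteq> word_val N u (\<gamma> y)" if "y \<in> V" "u \<in> ?W" "v \<in> ?W" for y u v
    proof
      assume "word_val N v c = word_val N u (\<gamma> y)"
      then have "g (y, u, v) = c"
        using word_val_bij[OF N, of v] c(1)
        by (simp add: g_def) (metis bij_betw_imp_inj_on inv_into_f_f)
      then have "c \<in> ?X" using that by (intro image_eqI[of _ _ "(y, u, v)"]) auto
      then show False using c(2) by blast
    qed
    show thesis
    proof (rule main[OF c(1)])
      show "word_val M u b = word_val M v (\<beta> y) \<longleftrightarrow> word_val N u c = word_val N v (\<gamma> y)"
        if "y \<in> V" "u \<in> ?W" "v \<in> ?W" for y u v
        using far[OF that(1,3,2)] that False by blast
    qed
  qed
qed

text \<open>Induction on the formula, with \<open>similar_extend\<close> used in both directions at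
  a quantifier: the radius doubles, and \<open>K\<close> grows to leave room for an element far from
  the values of the free variables. \<open>R\<close> and \<open>K\<close> depend on the formula
  only, so that one choice serves all identities at once.\<close>

lemma sat_transfer:
  fixes \<phi> :: "'f::finite fm"
  shows "\<exists>R K. \<forall>(M :: ('f, 'u) struct) (N :: ('f, 'v) struct) \<beta> \<gamma>.
    commuting_bijections M \<longrightarrow> commuting_bijections N \<longrightarrow> agree R M N \<longrightarrow>
    larger_than K M \<longrightarrow> larger_than K N \<longrightarrow> range \<beta> \<subseteq> universe M \<longrightarrow> range \<gamma> \<subseteq> universe N \<longrightarrow>
    similar R (fv \<phi>) M \<beta> N \<gamma> \<longrightarrow> sat M \<beta> \<phi> = sat N \<gamma> \<phi>"
proof (induction \<phi>)
  case (Eq s t)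
  show ?case
    by (rule exI[of _ "max (length (tword s)) (length (tword t))"])
      (auto simp: similar_def tval_word)
next
  case (Neg \<phi>)
  then show ?case by simp
next
  case (Imp \<phi> \<psi>)
  obtain R K where IH1: "\<forall>(M :: ('f, 'u) struct) (N :: ('f, 'v) struct) \<beta> \<gamma>.
      commuting_bijections M \<longrightarrow> commuting_bijections N \<longrightarrow> agree R M N \<longrightarrow>
      larger_than K M \<longrightarrow> larger_than K N \<longrightarrow> range \<beta> \<subseteq> universe M \<longrightarrow> range \<gamma> \<subseteq> universe N \<longrightarrow>
      similar R (fv \<phi>) M \<beta> N \<gamma> \<longrightarrow> sat M \<beta> \<phi> = sat N \<gamma> \<phi>"
    using Imp.IH(1) by (elim exE) (rule that)
  obtain R' K' where IH2: "\<forall>(M :: ('f, 'u) struct) (N :: ('f, 'v) struct) \<beta> \<gamma>.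
      commuting_bijections M \<longrightarrow> commuting_bijections N \<longrightarrow> agree R' M N \<longrightarrow>
      larger_than K' M \<longrightarrow> larger_than K' N \<longrightarrow> range \<beta> \<subseteq> universe M \<longrightarrow> range \<gamma> \<subseteq> universe N \<longrightarrow>
      similar R' (fv \<psi>) M \<beta> N \<gamma> \<longrightarrow> sat M \<beta> \<psi> = sat N \<gamma> \<psi>"
    using Imp.IH(2) by (elim exE) (rule that)
  show ?case
  proof (intro exI allI impI)
    fix M :: "('f, 'u) struct" and N :: "('f, 'v) struct" and \<beta> \<gamma>
    assume *: "commuting_bijections M" "commuting_bijections N" "agree (max R R') M N"
      "larger_than (max K K') M" "larger_than (max K K') N" "range \<beta> \<subseteq> universe M"
      "range \<gamma> \<subseteq> universe N" "similar (max R R') (fv (Imp \<phi> \<psi>)) M \<beta> N \<gamma>"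
    have "sat M \<beta> \<phi> = sat N \<gamma> \<phi>"
      by (rule IH1[rule_format]) (use * in \<open>auto elim: agree_mono larger_than_mono similar_mono\<close>)
    moreover have "sat M \<beta> \<psi> = sat N \<gamma> \<psi>"
      by (rule IH2[rule_format]) (use * in \<open>auto elim: agree_mono larger_than_mono similar_mono\<close>)
    ultimately show "sat M \<beta> (Imp \<phi> \<psi>) = sat N \<gamma> (Imp \<phi> \<psi>)" by simp
  qed
next
  case (Forall x \<phi>)
  obtain R K where IH: "\<forall>(M :: ('f, 'u) struct) (N :: ('f, 'v) struct) \<beta> \<gamma>.
      commuting_bijections M \<longrightarrow> commuting_bijections N \<longrightarrow> agree R M N \<longrightarrow>
      larger_than K M \<longrightarrow> larger_than K N \<longrightarrow> range \<beta> \<subseteq> universe M \<longrightarrow> range \<gamma> \<subseteq> universe N \<longrightarrow>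
      similar R (fv \<phi>) M \<beta> N \<gamma> \<longrightarrow> sat M \<beta> \<phi> = sat N \<gamma> \<phi>"
    using Forall.IH by (elim exE) (rule that)
  let ?V = "fv (Forall x \<phi>)"
  let ?K = "max K (card ?V * (card {w :: 'f list. length w \<le> R})\<^sup>2)"
  have V: "finite ?V" "x \<notin> ?V" "fv \<phi> \<subseteq> insert x ?V" using finite_fv[of \<phi>] by auto
  show ?case
  proof (intro exI allI impI)
    fix M :: "('f, 'u) struct" and N :: "('f, 'v) struct" and \<beta> \<gamma>
    assume *: "commuting_bijections M" "commuting_bijections N" "agree (2 * R) M N"
      "larger_than ?K M" "larger_than ?K N" "range \<beta> \<subseteq> universe M"
      "range \<gamma> \<subseteq> universe N" "similar (2 * R) ?V M \<beta> N \<gamma>"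
    have agr: "agree R M N" by (rule agree_mono[OF *(3)]) simp
    have large: "larger_than K M" "larger_than K N"
      "larger_than (card ?V * (card {w :: 'f list. length w \<le> R})\<^sup>2) M"
      "larger_than (card ?V * (card {w :: 'f list. length w \<le> R})\<^sup>2) N"
      by (rule larger_than_mono[OF *(4)] larger_than_mono[OF *(5)], simp)+
    have \<beta>: "\<beta> y \<in> universe M" and \<gamma>: "\<gamma> y \<in> universe N" for y using *(6,7) by auto
    have step: "sat M (\<beta>(x := b)) \<phi> = sat N (\<gamma>(x := c)) \<phi>"
      if "b \<in> universe M" "c \<in> universe N" "similar R (insert x ?V) M (\<beta>(x := b)) N (\<gamma>(x := c))" for b c
      by (rule IH[rule_format, OF *(1,2) agr large(1,2)])
        (use that \<beta> \<gamma> in \<open>auto intro!: similar_mono[OF that(3) order_refl V(3)]\<close>)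
    show "sat M \<beta> (Forall x \<phi>) = sat N \<gamma> (Forall x \<phi>)"
    proof
      assume all: "sat M \<beta> (Forall x \<phi>)"
      have "sat N (\<gamma>(x := c)) \<phi>" if c: "c \<in> universe N" for c
      proof -
        obtain b where "b \<in> universe M" "similar R (insert x ?V) N (\<gamma>(x := c)) M (\<beta>(x := b))"
          by (rule similar_extend[OF *(2,1) agree_sym[OF agr] V(1,2) large(3) similar_sym[OF *(8)] \<gamma> \<beta> c])
        then show ?thesis using step[OF _ c similar_sym] all by auto
      qed
      then show "sat N \<gamma> (Forall x \<phi>)" by simp
    next
      assume all: "sat N \<gamma> (Forall x \<phi>)"
      have "sat M (\<beta>(x := b)) \<phi>" if b: "b \<in> universe M" for b
      proof -
        obtain c where "c \<in> universe N" "similar R (insert x ?V) M (\<beta>(x := b)) N (\<gamma>(x := c))"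
          by (rule similar_extend[OF *(1,2) agr V(1,2) large(4) *(8) \<beta> \<gamma> b])
        then show ?thesis using step[OF b] all by (metis sat.simps(4))
      qed
      then show "sat M \<beta> (Forall x \<phi>)" by simp
    qed
  qed
qed

subsection \<open>Concentration of word weights\<close>

definition level :: "('f \<Rightarrow> int) \<Rightarrow> nat \<Rightarrow> int \<Rightarrow> 'f list set" where
  "level \<xi> l c = {w. length w = l \<and> sum_list (map \<xi> w) = c}"

text \<open>\<open>B\<close> bounds the concentration function of the weight of a uniformly random
  word of length \<open>l\<close>.\<close>

definition spread :: "('f::finite \<Rightarrow> int) \<Rightarrow> nat \<Rightarrow> real \<Rightarrow> bool" where
  "spread \<xi> l B \<longleftrightarrow> (\<forall>c. real (card (level \<xi> l c)) \<le> B * real CARD('f) ^ l)"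

lemma card_words: "card {w :: 'f::finite list. length w = l} = CARD('f) ^ l"
  using card_lists_length_eq[of "UNIV :: 'f set" l] by simp

lemma finite_words_eq: "finite {w :: 'f::finite list. length w = l}"
  using finite_lists_length_eq[of "UNIV :: 'f set" l] by simp

lemma finite_level: "finite (level (\<xi> :: 'f::finite \<Rightarrow> int) l c)"
  by (rule finite_subset[OF _ finite_words_eq[of l]]) (auto simp: level_def)

lemma card_level_add:
  fixes \<xi> :: "'f::finite \<Rightarrow> int"
  shows "card (level \<xi> (k + l) c) = (\<Sum>v | length v = k. card (level \<xi> l (c - sum_list (map \<xi> v))))"
proof -
  have "level \<xi> (k + l) c = (\<Union>v \<in> {v. length v = k}. (@) v ` level \<xi> l (c - sum_list (map \<xi> v)))"
  proof (intro set_eqI iffI)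
    fix w assume "w \<in> level \<xi> (k + l) c"
    then have w: "length w = k + l" "sum_list (map \<xi> (take k w @ drop k w)) = c"
      by (auto simp: level_def)
    have "drop k w \<in> level \<xi> l (c - sum_list (map \<xi> (take k w)))"
      using w(1) w(2)[unfolded map_append sum_list_append] by (simp add: level_def)
    moreover have "w = take k w @ drop k w" "length (take k w) = k" using w(1) by simp_all
    ultimately show "w \<in> (\<Union>v \<in> {v. length v = k}. (@) v ` level \<xi> l (c - sum_list (map \<xi> v)))"
      by blast
  qed (auto simp: level_def)
  also have "card \<dots> = (\<Sum>v | length v = k. card ((@) v ` level \<xi> l (c - sum_list (map \<xi> v))))"
    by (rule card_UN_disjoint) (auto simp: finite_words_eq finite_level)
  also have "\<dots> = (\<Sum>v | length v = k. card (level \<xi> l (c - sum_list (map \<xi> v))))"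
    by (intro sum.cong refl card_image) (simp add: inj_on_def)
  finally show ?thesis .
qed

text \<open>Condition on the prefix of length \<open>k\<close>: the bound is uniform in the target
  weight, so it survives averaging.\<close>

lemma spread_add:
  fixes \<xi> :: "'f::finite \<Rightarrow> int"
  assumes "spread \<xi> l B"
  shows "spread \<xi> (k + l) B"
  unfolding spread_def
proof
  fix c
  have "real (card (level \<xi> (k + l) c)) \<le> (\<Sum>v | length (v :: 'f list) = k. B * real CARD('f) ^ l)"
    unfolding card_level_add of_nat_sum by (rule sum_mono) (use assms in \<open>simp add: spread_def\<close>)
  then show "real (card (level \<xi> (k + l) c)) \<le> B * real CARD('f) ^ (k + l)"
    by (simp add: card_words power_add mult_ac)
qed

text \<open>
  Among the prefixes of length \<open>k\<close> there are \<open>k + 1\<close> with distinct weights; the words completing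
  these to weight \<open>c\<close> form disjoint sets, so that together they number at most \<open>CARD('f) ^ l\<close>.
\<close>

lemma spread_contract:
  fixes \<xi> :: "'f::finite \<Rightarrow> int" and k l :: nat
  assumes ab: "\<xi> a \<noteq> \<xi> b" and B: "spread \<xi> l B"
  defines "\<delta> \<equiv> 1 / real CARD('f) ^ k"
  shows "spread \<xi> (k + l) (\<delta> + (1 - (real k + 1) * \<delta>) * B)"
    and "(real k + 1) * \<delta> \<le> 1"
proof -
  let ?n = "real CARD('f)" and ?V = "{v :: 'f list. length v = k}" and ?w = "\<lambda>v. sum_list (map \<xi> v)"
  \<comment> \<open>Exchanging one \<open>b\<close> for an \<open>a\<close> shifts the weight by the
    nonzero \<open>\<xi> a - \<xi> b\<close>, which makes the \<open>k + 1\<close> weights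
    distinct.\<close>
  define p where "p j = replicate j a @ replicate (k - j) b" for j
  have wp: "?w (p j) = int k * \<xi> b + int j * (\<xi> a - \<xi> b)" if "j \<le> k" for j
    using that by (simp add: p_def sum_list_replicate algebra_simps of_nat_diff)
  have inj: "inj_on (\<lambda>j. ?w (p j)) {..k}" using ab by (auto simp: inj_on_def wp)
  define V0 where "V0 = p ` {..k}"
  have V0: "V0 \<subseteq> ?V" by (auto simp: V0_def p_def)
  have fin: "finite V0" by (simp add: V0_def)
  have inj_p: "inj_on p {..k}" using inj by (auto simp: inj_on_def)
  have card_V0: "card V0 = k + 1" by (simp add: V0_def card_image[OF inj_p])
  have injw: "inj_on ?w V0" using inj by (auto simp: V0_def inj_on_def)
  have card_V: "real (card (?V - V0)) = ?n ^ k - (real k + 1)"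
    using card_Diff_subset[OF fin V0] card_mono[OF finite_words_eq V0] card_words[of k, where 'f = 'f]
    by (simp add: card_V0 of_nat_diff)
  have n: "?n > 0" by simp
  have k: "real k + 1 \<le> ?n ^ k" using card_V by simp
  then show "(real k + 1) * \<delta> \<le> 1" using n by (simp add: \<delta>_def field_simps)
  show "spread \<xi> (k + l) (\<delta> + (1 - (real k + 1) * \<delta>) * B)"
    unfolding spread_def
  proof
    fix c
    let ?L = "\<lambda>v. level \<xi> l (c - ?w v)"
    have "(\<Sum>v\<in>V0. card (?L v)) = card (\<Union>v\<in>V0. ?L v)"
      using injw
      by (intro card_UN_disjoint[symmetric] fin ballI finite_level) (auto simp: level_def inj_on_def)
    also have "\<dots> \<le> card {w :: 'f list. length w = l}"
      by (rule card_mono[OF finite_words_eq]) (auto simp: level_def)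
    finally have sum0: "real (\<Sum>v\<in>V0. card (?L v)) \<le> ?n ^ l"
      unfolding card_words of_nat_power[symmetric] of_nat_le_iff .
    have sum1: "real (\<Sum>v\<in>?V - V0. card (?L v)) \<le> (?n ^ k - (real k + 1)) * (B * ?n ^ l)"
      unfolding card_V[symmetric] of_nat_sum
      by (rule sum_bounded_above) (use B in \<open>simp add: spread_def\<close>)
    have "card (level \<xi> (k + l) c) = (\<Sum>v\<in>?V - V0. card (?L v)) + (\<Sum>v\<in>V0. card (?L v))"
      unfolding card_level_add by (rule sum.subset_diff[OF V0 finite_words_eq])
    then have "real (card (level \<xi> (k + l) c)) \<le> (?n ^ k - (real k + 1)) * (B * ?n ^ l) + ?n ^ l"
      using sum0 sum1 by linarith
    also have "\<dots> = (\<delta> + (1 - (real k + 1) * \<delta>) * B) * ?n ^ (k + l)"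
      using n by (simp add: \<delta>_def power_add field_simps)
    finally show "real (card (level \<xi> (k + l) c)) \<le> (\<delta> + (1 - (real k + 1) * \<delta>) * B) * ?n ^ (k + l)" .
  qed
qed

text \<open>One use of \<open>spread_contract\<close> replaces a bound \<open>B\<close> by
  \<open>\<delta> + q * B\<close>, where \<open>0 \<le> q < 1\<close>. The fixed point of this map
  is \<open>1 / (real k + 1)\<close>, approached geometrically. So \<open>k\<close> is chosen to
  make the limit small, then \<open>j\<close> to make the error \<open>q ^ j\<close> small;
  \<open>spread_add\<close> keeps the bound for all greater lengths.\<close>

lemma spread_small:
  fixes \<xi> :: "'f::finite \<Rightarrow> int"
  assumes ab: "\<xi> a \<noteq> \<xi> b" and e: "e > 0"
  obtains L where "\<And>l. L \<le> l \<Longrightarrow> spread \<xi> l e"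
proof -
  obtain k where k: "1 / (real k + 1) < e / 2"
    using reals_Archimedean[of "e / 2"] e by (auto simp: inverse_eq_divide add_ac)
  define \<delta> where "\<delta> = 1 / real CARD('f) ^ k"
  define q where "q = 1 - (real k + 1) * \<delta>"
  have base: "real (card (level \<xi> 0 c)) \<le> 1" for c
  proof -
    have "card (level \<xi> 0 c) \<le> card {[] :: 'f list}"
      by (rule card_mono) (auto simp: level_def)
    then show ?thesis by simp
  qed
  then have "spread \<xi> 0 1" by (simp add: spread_def)
  moreover have "\<delta> > 0" by (simp add: \<delta>_def)
  ultimately have q: "0 \<le> q" "q < 1"
    using spread_contract(2)[OF ab, of 0 1 k] by (simp_all add: q_def \<delta>_def)
  have iter: "spread \<xi> (j * k) (1 / (real k + 1) + q ^ j)" for j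
  proof (induction j)
    case 0
    have "real (card (level \<xi> 0 c)) \<le> 1 / (real k + 1) + q ^ 0" for c
      by (rule order_trans[OF base]) simp
    then show ?case by (simp add: spread_def)
  next
    case (Suc j)
    have "\<delta> + q * (1 / (real k + 1) + q ^ j) = 1 / (real k + 1) + q ^ Suc j"
      by (simp add: q_def field_simps)
    then show ?case using spread_contract(1)[OF ab Suc, of k] by (simp add: q_def \<delta>_def)
  qed
  obtain j where j: "q ^ j < e / 2"
    using real_arch_pow_inv[of "e / 2" q] e q by auto
  show thesis
  proof (rule that[of "j * k"])
    fix l assume "j * k \<le> l"
    then have "spread \<xi> l (1 / (real k + 1) + q ^ j)"
      using spread_add[OF iter, of "l - j * k" j] by simp
    moreover have "1 / (real k + 1) + q ^ j \<le> e" using j k by simp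
    ultimately show "spread \<xi> l e"
      unfolding spread_def by (meson mult_right_mono order_trans zero_le_power of_nat_0_le_iff)
  qed
qed

section \<open>Sets of identities of density zero\<close>

definition negligible :: "('f::finite list \<times> 'f list) set \<Rightarrow> bool" where
  "negligible A \<longleftrightarrow> (\<lambda>s. real (card (A \<inter> idents_upto s)) /
     real (card (idents_upto s :: ('f list \<times> 'f list) set))) \<longlonglongrightarrow> 0"

lemma finite_idents_upto: "finite (idents_upto s :: ('f::finite list \<times> 'f list) set)"
proof (rule finite_subset)
  show "idents_upto s \<subseteq> {w :: 'f list. length w \<le> s} \<times> {w. length w \<le> s}"
    by (auto simp: idents_upto_def)
  show "finite ({w :: 'f list. length w \<le> s} \<times> {w :: 'f list. length w \<le> s})"
    by (intro finite_cartesian_product finite_words)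
qed

lemma negligible_subset:
  assumes "negligible B" "A \<subseteq> B"
  shows "negligible A"
  unfolding negligible_def
proof (rule tendsto_sandwich[OF _ _ tendsto_const assms(1)[unfolded negligible_def]])
  show "\<forall>\<^sub>F s in sequentially. real (card (A \<inter> idents_upto s)) / real (card (idents_upto s :: ('a list \<times> 'a list) set))
      \<le> real (card (B \<inter> idents_upto s)) / real (card (idents_upto s :: ('a list \<times> 'a list) set))"
    using assms(2)
    by (intro always_eventually allI divide_right_mono of_nat_mono card_mono)
      (auto simp: finite_idents_upto)
qed simp

lemma negligible_Un:
  assumes "negligible A" "negligible B"
  shows "negligible (A \<union> B)"
  unfolding negligible_def
proof (rule tendsto_sandwich[OF _ _ tendsto_const])
  let ?N = "\<lambda>s. real (card (idents_upto s :: ('a list \<times> 'a list) set))"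
  have "real (card ((A \<union> B) \<inter> idents_upto s)) \<le> real (card (A \<inter> idents_upto s)) + real (card (B \<inter> idents_upto s))" for s
    using card_Un_le[of "A \<inter> idents_upto s" "B \<inter> idents_upto s"] by (simp add: Int_Un_distrib2)
  then show "\<forall>\<^sub>F s in sequentially. real (card ((A \<union> B) \<inter> idents_upto s)) / ?N s
      \<le> real (card (A \<inter> idents_upto s)) / ?N s + real (card (B \<inter> idents_upto s)) / ?N s"
    by (simp add: divide_right_mono flip: add_divide_distrib)
  show "(\<lambda>s. real (card (A \<inter> idents_upto s)) / ?N s + real (card (B \<inter> idents_upto s)) / ?N s) \<longlonglongrightarrow> 0"
    using tendsto_add[OF assms[unfolded negligible_def]] by simp
qed simp

lemma negligible_UN:
  assumes "finite I" "\<And>i. i \<in> I \<Longrightarrow> negligible (A i)"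
  shows "negligible (\<Union>i\<in>I. A i)"
  using assms by (induction I rule: finite_induct) (auto simp: negligible_Un, simp add: negligible_def)

definition split_at :: "nat \<times> nat \<Rightarrow> ('f list \<times> 'f list) set" where
  "split_at ij = {t. length t = fst ij} \<times> {t'. length t' = snd ij}"

lemma card_split_at: "card (split_at ij :: ('f::finite list \<times> 'f list) set) = CARD('f) ^ (fst ij + snd ij)"
  by (simp add: split_at_def card_cartesian_product card_words power_add)

lemma finite_split_at: "finite (split_at ij :: ('f::finite list \<times> 'f list) set)"
  by (simp add: split_at_def finite_words_eq)

lemma finite_lengths: "finite {ij :: nat \<times> nat. fst ij + snd ij \<le> s}"
  by (rule finite_subset[of _ "{..s} \<times> {..s}"]) auto

lemma idents_upto_split: "idents_upto s = (\<Union>ij \<in> {ij. fst ij + snd ij \<le> s}. split_at ij)"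
  by (auto simp: idents_upto_def split_at_def)

lemma card_idents_upto:
  "card (idents_upto s :: ('f::finite list \<times> 'f list) set) =
    (\<Sum>ij | fst ij + snd ij \<le> s. CARD('f) ^ (fst ij + snd ij))"
  unfolding idents_upto_split
  by (subst card_UN_disjoint) (auto simp: finite_lengths finite_split_at card_split_at, auto simp: split_at_def)

text \<open>The total count is unbounded, which lets a fixed finite set of identities be
  neglected.\<close>

lemma le_card_idents_upto: "s \<le> card (idents_upto s :: ('f::finite list \<times> 'f list) set)"
proof -
  have "card ((\<lambda>i. (replicate i (undefined :: 'f), [] :: 'f list)) ` {..s}) \<le> card (idents_upto s :: ('f list \<times> 'f list) set)"
    by (rule card_mono[OF finite_idents_upto]) (auto simp: idents_upto_def)
  moreover have "inj (\<lambda>i. (replicate i (undefined :: 'f), [] :: 'f list))"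
    by (auto simp: inj_on_def dest: arg_cong[of _ _ length])
  ultimately show ?thesis by (simp add: card_image inj_on_subset)
qed

text \<open>Fixing one side prescribes the weight of the other. So fix the side that may be short
  and apply \<open>spread\<close> to the long one.\<close>

lemma card_weight_diff_split:
  fixes \<xi> :: "'f::finite \<Rightarrow> int"
  assumes L: "\<And>l. L \<le> l \<Longrightarrow> spread \<xi> l e" and ij: "L \<le> i \<or> L \<le> j"
  shows "real (card ({(t, t'). sum_list (map \<xi> t) - sum_list (map \<xi> t') = x} \<inter> split_at (i, j)))
    \<le> e * real CARD('f) ^ (i + j)" (is "real (card ?A) \<le> _")
proof -
  let ?n = "real CARD('f)" and ?w = "\<lambda>t. sum_list (map \<xi> t)"
  show ?thesis
  proof (cases "L \<le> i")
    case True
    have "?A = (\<Union>t' \<in> {t'. length t' = j}. (\<lambda>t. (t, t')) ` level \<xi> i (x + ?w t'))"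
      by (auto simp: split_at_def level_def)
    then have "card ?A = (\<Sum>t' | length t' = j. card (level \<xi> i (x + ?w t')))"
      by (simp, subst card_UN_disjoint) (auto simp: finite_words_eq finite_level card_image inj_on_def)
    then have "real (card ?A) = (\<Sum>t' | length t' = j. real (card (level \<xi> i (x + ?w t'))))" by simp
    also have "\<dots> \<le> real (card {t' :: 'f list. length t' = j}) * (e * ?n ^ i)"
      by (rule sum_bounded_above) (use L[OF True] in \<open>simp add: spread_def\<close>)
    finally show ?thesis by (simp add: card_words power_add mult_ac)
  next
    case False
    have "?A = (\<Union>t \<in> {t. length t = i}. Pair t ` level \<xi> j (?w t - x))"
      by (auto simp: split_at_def level_def)
    then have "card ?A = (\<Sum>t | length t = i. card (level \<xi> j (?w t - x)))"
      by (simp, subst card_UN_disjoint) (auto simp: finite_words_eq finite_level card_image inj_on_def)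
    then have "real (card ?A) = (\<Sum>t | length t = i. real (card (level \<xi> j (?w t - x))))" by simp
    also have "\<dots> \<le> real (card {t :: 'f list. length t = i}) * (e * ?n ^ j)"
      by (rule sum_bounded_above) (use L ij False in \<open>simp add: spread_def\<close>)
    finally show ?thesis by (simp add: card_words power_add mult_ac)
  qed
qed

text \<open>Identities with both sides shorter than \<open>L\<close> all lie in the fixed finite set
  \<open>idents_upto (2 * L)\<close>. For every other pair of lengths at most the fraction
  \<open>e / 2\<close> of the identities has difference \<open>x\<close>.\<close>

lemma negligible_weight_diff:
  fixes \<xi> :: "'f::finite \<Rightarrow> int"
  assumes ab: "\<xi> a \<noteq> \<xi> b"
  shows "negligible {(t, t'). sum_list (map \<xi> t) - sum_list (map \<xi> t') = x}" (is "negligible ?A")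
  unfolding negligible_def
proof (rule LIMSEQ_I)
  fix e :: real assume e: "0 < e"
  let ?n = "real CARD('f)" and ?I = "\<lambda>s. idents_upto s :: ('f list \<times> 'f list) set"
  obtain L where L: "\<And>l. L \<le> l \<Longrightarrow> spread \<xi> l (e / 2)"
    using spread_small[OF ab, of "e / 2"] e by auto
  define C where "C = real (card (?I (2 * L)))"
  \<comment> \<open>From \<open>s0\<close> on, the short identities, at most \<open>C\<close> in
    number, make up less than the remaining fraction \<open>e / 2\<close> of the total.\<close>
  obtain s0 where s0: "2 * C / e < real s0" using reals_Archimedean2 by blast
  show "\<exists>s0. \<forall>s\<ge>s0. norm (real (card (?A \<inter> ?I s)) / real (card (?I s)) - 0) < e"
  proof (intro exI allI impI)
    fix s assume s: "s0 \<le> s"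
    let ?D = "{ij :: nat \<times> nat. fst ij + snd ij \<le> s}" and ?B = "\<lambda>ij. ?A \<inter> split_at ij"
    let ?D' = "{ij \<in> ?D. L \<le> fst ij \<or> L \<le> snd ij}"
    have fin: "finite ?D'" by (rule finite_subset[OF _ finite_lengths[of s]]) auto
    have "?A \<inter> ?I s \<subseteq> ?I (2 * L) \<union> (\<Union>ij \<in> ?D'. ?B ij)"
      by (auto simp: idents_upto_def split_at_def)
    then have "card (?A \<inter> ?I s) \<le> card (?I (2 * L) \<union> (\<Union>ij \<in> ?D'. ?B ij))"
      by (rule card_mono[rotated]) (use fin in \<open>auto simp: finite_idents_upto finite_split_at\<close>)
    also have "\<dots> \<le> card (?I (2 * L)) + (\<Sum>ij \<in> ?D'. card (?B ij))"
      by (rule order_trans[OF card_Un_le add_left_mono[OF card_UN_le[OF fin]]])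
    finally have "real (card (?A \<inter> ?I s)) \<le> C + (\<Sum>ij \<in> ?D'. real (card (?B ij)))"
      unfolding C_def by (simp flip: of_nat_sum of_nat_add)
    also have "(\<Sum>ij \<in> ?D'. real (card (?B ij))) \<le> (\<Sum>ij \<in> ?D'. e / 2 * ?n ^ (fst ij + snd ij))"
    proof (rule sum_mono)
      fix ij assume "ij \<in> ?D'"
      then show "real (card (?B ij)) \<le> e / 2 * ?n ^ (fst ij + snd ij)"
        using card_weight_diff_split[OF L, where i = "fst ij" and j = "snd ij" and x = x] by simp
    qed
    also have "\<dots> \<le> (\<Sum>ij \<in> ?D. e / 2 * ?n ^ (fst ij + snd ij))"
      by (rule sum_mono2[OF finite_lengths]) (use e in auto)
    also have "\<dots> = e / 2 * real (card (?I s))"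
      by (simp add: card_idents_upto sum_distrib_left)
    finally have le: "real (card (?A \<inter> ?I s)) \<le> C + e / 2 * real (card (?I s))" by simp
    have "real s \<le> real (card (?I s))" using le_card_idents_upto[of s, where 'f = 'f] by simp
    then have big: "2 * C / e < real (card (?I s))" using s0 s by linarith
    moreover have "0 \<le> 2 * C / e" using e by (simp add: C_def)
    ultimately have pos: "0 < real (card (?I s))" by linarith
    have "C < e / 2 * real (card (?I s))" using big e by (simp add: field_simps)
    then have "real (card (?A \<inter> ?I s)) < e * real (card (?I s))" using le by simp
    then show "norm (real (card (?A \<inter> ?I s)) / real (card (?I s)) - 0) < e"
      using pos by (simp add: divide_less_eq)
  qed
qed

subsection \<open>Weights on finitely generated abelian groups\<close>

definition weight :: "('f \<Rightarrow> int) \<Rightarrow> 'f multiset \<Rightarrow> int" where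
  "weight \<xi> A = (\<Sum>i\<in>#A. \<xi> i)"

lemma weight_simps [simp]:
  "weight \<xi> {#} = 0" "weight \<xi> (add_mset i A) = \<xi> i + weight \<xi> A" "weight \<xi> (A + B) = weight \<xi> A + weight \<xi> B"
  by (simp_all add: weight_def)

lemma weight_repeat [simp]: "weight \<xi> (repeat_mset k A) = int k * weight \<xi> A"
  by (induction k) (simp_all add: algebra_simps)

lemma weight_mset: "weight \<xi> (mset w) = sum_list (map \<xi> w)"
  by (induction w) simp_all

lemma repeat_mset_add: "repeat_mset (j + k) A = repeat_mset j A + repeat_mset k A"
  by (simp add: multiset_eq_iff algebra_simps)

text \<open>A congruence on the free commutative monoid whose quotient is a group. Inverses are
  asked for single symbols; \<open>ex_inverse\<close> composes them.\<close>

locale abelian_group_relation =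
  fixes E :: "'f::finite multiset \<Rightarrow> 'f multiset \<Rightarrow> bool" (infix "\<sim>" 50)
  assumes rel_refl: "A \<sim> A"
    and rel_sym: "A \<sim> B \<Longrightarrow> B \<sim> A"
    and rel_trans [trans]: "A \<sim> B \<Longrightarrow> B \<sim> C \<Longrightarrow> A \<sim> C"
    and rel_add_left: "A \<sim> B \<Longrightarrow> C + A \<sim> C + B"
    and rel_inverse: "\<exists>A. add_mset i A \<sim> {#}"
begin

lemma rel_add: "A \<sim> B \<Longrightarrow> C \<sim> D \<Longrightarrow> A + C \<sim> B + D"
  by (metis rel_add_left rel_trans union_commute)

lemma ex_inverse: "\<exists>B. A + B \<sim> {#}"
proof (induction A)
  case empty
  then show ?case by (metis rel_refl add_0)
next
  case (add i A)
  then obtain B C where "A + B \<sim> {#}" "add_mset i C \<sim> {#}" using rel_inverse by blast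
  then have "A + B + add_mset i C \<sim> {#} + {#}" by (rule rel_add)
  then have "add_mset i A + (B + C) \<sim> {#}" by (simp add: add_ac)
  then show ?case by blast
qed

lemma rel_cancel: "C + A \<sim> C + B \<longleftrightarrow> A \<sim> B"
proof
  assume *: "C + A \<sim> C + B"
  obtain D where D: "C + D \<sim> {#}" using ex_inverse by blast
  have absorb: "C + D + X \<sim> X" for X
    using rel_add[OF D rel_refl[of X]] by simp
  have "C + D + A \<sim> C + D + B" using rel_add_left[OF *, of D] by (simp add: add_ac)
  then show "A \<sim> B" using absorb rel_sym rel_trans by blast
qed (rule rel_add_left)

lemma rel_cancel_right: "A + C \<sim> B + C \<longleftrightarrow> A \<sim> B"
  using rel_cancel[of C A B] by (simp add: add.commute)

lemma rel_repeat: "A \<sim> B \<Longrightarrow> repeat_mset k A \<sim> repeat_mset k B"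
  by (induction k) (auto intro: rel_add rel_refl)

text \<open>This says that \<open>P - Q\<close> has finite order in the quotient group. Two
  arguments are needed because the difference is in general not a multiset.\<close>

definition torsion :: "'f multiset \<Rightarrow> 'f multiset \<Rightarrow> bool" where
  "torsion P Q \<longleftrightarrow> (\<exists>m > 0. repeat_mset m P \<sim> repeat_mset m Q)"

text \<open>If \<open>m i\<close> copies of \<open>i\<close> are trivial, they can be deleted as
  long as they occur. What remains has fewer than \<open>m i\<close> copies of each
  \<open>i\<close>.\<close>

lemma torsion_imp_finite_classes:
  assumes tors: "\<And>i. torsion {#i#} {#}"
  obtains K where "\<And>A. \<exists>B. size B \<le> K \<and> A \<sim> B"
proof -
  obtain m where m: "m i > 0" "repeat_mset (m i) {#i#} \<sim> {#}" for i
    using tors by (simp add: torsion_def) metis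
  show thesis
  proof (rule that[of "\<Sum>i\<in>UNIV. m i"])
    fix A
    show "\<exists>B. size B \<le> (\<Sum>i\<in>UNIV. m i) \<and> A \<sim> B"
    proof (induction "size A" arbitrary: A rule: less_induct)
      case less
      show ?case
      proof (cases "\<exists>i. m i \<le> count A i")
        case True
        then obtain i where "repeat_mset (m i) {#i#} \<subseteq># A"
          by (auto simp: repeat_mset_replicate_mset count_le_replicate_mset_subset_eq)
        then obtain B where B: "A = repeat_mset (m i) {#i#} + B" by (auto simp: subset_mset.le_iff_add)
        have "A \<sim> B" using rel_add[OF m(2)[of i] rel_refl[of B]] by (simp add: B)
        moreover have "size B < size A" using m(1)[of i] by (simp add: B)
        ultimately show ?thesis using less rel_trans by blast
      next
        case False
        have "size A = (\<Sum>i\<in>UNIV. count A i)"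
          by (simp add: size_multiset_overloaded_eq sum.mono_neutral_left count_eq_zero_iff)
        also have "\<dots> \<le> (\<Sum>i\<in>UNIV. m i)" using False by (intro sum_mono) (meson linear not_le less_imp_le)
        finally show ?thesis using rel_refl by blast
      qed
    qed
  qed
qed

definition lattice_vec :: "'f multiset \<Rightarrow> rat ^ 'f" where
  "lattice_vec A = (\<chi> i. of_nat (count A i))"

lemma lattice_vec_simps [simp]:
  "lattice_vec {#} = 0" "lattice_vec (A + B) = lattice_vec A + lattice_vec B"
  "lattice_vec (repeat_mset k A) = of_nat k *s lattice_vec A"
  by (simp_all add: lattice_vec_def vec_eq_iff)

lemma lattice_vec_add_mset: "lattice_vec (add_mset i A) = axis i 1 + lattice_vec A"
  by (auto simp: lattice_vec_def vec_eq_iff axis_def)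

lemma lattice_vec_inject: "lattice_vec A = lattice_vec B \<longleftrightarrow> A = B"
  by (auto simp: lattice_vec_def vec_eq_iff multiset_eq_iff)

text \<open>Clear denominators: relations can be added and multiplied by natural numbers, so a
  suitable multiple of a rational combination of relations is itself a relation.\<close>

lemma span_relations:
  assumes "x \<in> vec.span {lattice_vec A - lattice_vec B | A B. A \<sim> B}"
  shows "\<exists>N > 0. \<exists>A B. A \<sim> B \<and> of_nat N *s x = lattice_vec A - lattice_vec B"
  using assms
proof (induction rule: vec.span_induct_alt)
  case base
  have "of_nat 1 *s 0 = lattice_vec {#} - lattice_vec {#}" by simp
  then show ?case using rel_refl zero_less_one by metis
next
  case (step c x y)
  obtain N A B where N: "N > 0" "A \<sim> B" "of_nat N *s y = lattice_vec A - lattice_vec B"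
    using step.IH by blast
  obtain C D where C: "C \<sim> D" "x = lattice_vec C - lattice_vec D" using step.hyps by blast
  obtain n d where nd: "c = rat_of_int n / rat_of_int d" "d > 0"
    by (metis quotient_of_div quotient_of_denom_pos surj_pair)
  \<comment> \<open>For a negative numerator the sides of the relation are exchanged, which keeps
    the multiplicity a natural number.\<close>
  obtain k C' D' where k: "C' \<sim> D'" "rat_of_int n *s x = rat_of_nat k *s (lattice_vec C' - lattice_vec D')"
  proof (cases "n \<ge> 0")
    case True
    then show thesis using that[of C D "nat n"] C by simp
  next
    case False
    then show thesis using that[of D C "nat (- n)"] C rel_sym
      by (simp add: vec_eq_iff algebra_simps)
  qed
  let ?d = "nat d" let ?A = "repeat_mset (N * k) C' + repeat_mset ?d A"
  let ?B = "repeat_mset (N * k) D' + repeat_mset ?d B"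
  have d: "rat_of_nat ?d = rat_of_int d" using nd(2) by simp
  have "?A \<sim> ?B" using k(1) N(2) by (intro rel_add rel_repeat)
  moreover have "of_nat (N * ?d) *s (c *s x + y) = lattice_vec ?A - lattice_vec ?B"
  proof -
    have "of_nat (N * ?d) *s (c *s x + y) = of_nat N *s (rat_of_int n *s x) + of_nat ?d *s (of_nat N *s y)"
      using nd by (simp add: vec_eq_iff field_simps d)
    also have "\<dots> = lattice_vec ?A - lattice_vec ?B"
      by (simp add: k(2) N(3)) (simp add: vec_eq_iff algebra_simps)
    finally show ?thesis .
  qed
  moreover have "N * ?d > 0" using N(1) nd(2) by simp
  ultimately show ?case by blast
qed

text \<open>By \<open>span_relations\<close>, \<open>P - Q\<close> would be torsion if it lay in the
  rational span of the relations. So some linear functional vanishes on that span but not at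
  \<open>P - Q\<close>, and an integer multiple of it is a weight.\<close>

lemma separating_weight:
  assumes "\<not> torsion P Q"
  obtains \<xi> where "\<And>A B. A \<sim> B \<Longrightarrow> weight \<xi> A = weight \<xi> B" "weight \<xi> P \<noteq> weight \<xi> Q"
proof -
  let ?S = "{lattice_vec A - lattice_vec B | A B. A \<sim> B}" and ?b = "lattice_vec P - lattice_vec Q"
  have b: "?b \<notin> vec.span ?S"
  proof
    assume "?b \<in> vec.span ?S"
    then obtain N A B where N: "N > 0" "A \<sim> B" "of_nat N *s ?b = lattice_vec A - lattice_vec B"
      using span_relations by blast
    then have "lattice_vec (repeat_mset N P + B) = lattice_vec (repeat_mset N Q + A)"
      by (simp add: vec_eq_iff algebra_simps)
    then have "repeat_mset N P + B = repeat_mset N Q + A" by (simp only: lattice_vec_inject)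
    then have "repeat_mset N P + B \<sim> repeat_mset N Q + B"
      using rel_add_left[OF N(2), of "repeat_mset N Q"] rel_sym by metis
    then show False using N(1) assms unfolding torsion_def rel_cancel_right by blast
  qed
  \<comment> \<open>A linear map can be prescribed freely on an independent set, so
    \<open>?S\<close> is replaced by a basis of its span.\<close>
  obtain K where K: "K \<subseteq> ?S" "vec.independent K" "?S \<subseteq> vec.span K"
    by (rule vec.maximal_independent_subset)
  have bK: "?b \<notin> vec.span K" using b vec.span_mono[OF K(1)] by blast
  then have "vec.independent (insert ?b K)" using K(2) vec.independent_insertI by blast
  from vec.linear_independent_extend[OF this, of "\<lambda>x. if x = ?b then ?b else 0"]
  obtain g where g: "Vector_Spaces.linear (*s) (*s) g"
    "\<forall>x \<in> insert ?b K. g x = (if x = ?b then ?b else 0)"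
    by (elim exE conjE) (rule that)
  interpret g: Vector_Spaces.linear "(*s)" "(*s)" g by (rule g(1))
  have "\<forall>x \<in> K. g x = 0" using g(2) bK vec.span_base by fastforce
  then have g0: "g x = 0" if "x \<in> ?S" for x
    using g.eq_0_on_span K(3) that by blast
  have "g ?b \<noteq> 0" using g(2) bK vec.span_zero by (metis insertI1)
  \<comment> \<open>\<open>g\<close> is vector valued; a coordinate not vanishing at
    \<open>?b\<close> makes it a functional.\<close>
  then obtain m where m: "g ?b $ m \<noteq> 0" by (auto simp: vec_eq_iff)
  define h where "h i = g (axis i 1) $ m" for i
  \<comment> \<open>A common denominator of the values of the functional on the unit vectors, that
    is, on the single symbols.\<close>
  define N where "N = (\<Prod>i\<in>UNIV. snd (quotient_of (h i)))"
  have N: "N \<noteq> 0" using quotient_of_denom_pos' by (auto simp: N_def) (metis less_irrefl)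
  have "\<exists>z. of_int N * h i = of_int z" for i
  proof -
    obtain a d where ad: "quotient_of (h i) = (a, d)" by force
    have "d dvd N" unfolding N_def using dvd_prodI[of UNIV i "\<lambda>i. snd (quotient_of (h i))"] ad by simp
    then obtain e where "N = d * e" by blast
    then have "of_int N * h i = of_int (e * a)"
      using quotient_of_div[OF ad] quotient_of_denom_pos[OF ad] by simp
    then show ?thesis by blast
  qed
  then obtain \<xi> where \<xi>: "\<And>i. of_int N * h i = of_int (\<xi> i)" by metis
  have weight: "of_int (weight \<xi> A) = of_int N * g (lattice_vec A) $ m" for A
    by (induction A) (simp_all add: lattice_vec_add_mset g.add g.zero \<xi>[symmetric] h_def algebra_simps)
  have diff: "of_int (weight \<xi> A - weight \<xi> B) = of_int N * g (lattice_vec A - lattice_vec B) $ m" for A B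
    by (simp add: weight g.diff algebra_simps)
  show thesis
  proof (rule that)
    fix A B assume "A \<sim> B"
    then have "g (lattice_vec A - lattice_vec B) = 0" by (intro g0) blast
    then show "weight \<xi> A = weight \<xi> B" using diff[of A B] by simp
  next
    show "weight \<xi> P \<noteq> weight \<xi> Q" using diff[of P Q] m N by auto
  qed
qed

lemma weight_not_constant:
  assumes \<xi>: "\<And>A B. A \<sim> B \<Longrightarrow> weight \<xi> A = weight \<xi> B" and nz: "weight \<xi> P \<noteq> weight \<xi> Q"
  obtains i j where "\<xi> i \<noteq> \<xi> j"
proof (rule ccontr)
  assume "\<not> thesis"
  then have const: "\<xi> i = \<xi> j" for i j using that by blast
  obtain i where i: "\<xi> i \<noteq> 0"
  proof (rule ccontr)
    assume "\<not> thesis"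
    then have "\<xi> = (\<lambda>_. 0)" using that by blast
    then show False using nz by (simp add: weight_def)
  qed
  have weight: "weight \<xi> A = int (size A) * \<xi> i" for A
    by (induction A) (use const[of _ i] in \<open>simp_all add: algebra_simps\<close>)
  obtain A where "add_mset i A \<sim> {#}" using rel_inverse by blast
  then have "(int (size A) + 1) * \<xi> i = 0" using \<xi>[of "add_mset i A" "{#}"]
    by (simp add: weight algebra_simps)
  then show False using i by simp
qed

text \<open>Equality modulo the subgroup generated by \<open>S - T\<close>: the formula reads
  \<open>A - B = (k - j)(S - T)\<close>, with the integer coefficient split into two natural
  numbers.\<close>

definition adjoin :: "'f multiset \<Rightarrow> 'f multiset \<Rightarrow> 'f multiset \<Rightarrow> 'f multiset \<Rightarrow> bool" where
  "adjoin S T A B \<longleftrightarrow> (\<exists>j k. A + repeat_mset j S + repeat_mset k T \<sim> B + repeat_mset k S + repeat_mset j T)"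

lemma adjoin_generator: "adjoin S T S T"
  unfolding adjoin_def using rel_refl[of "S + T"]
  by (intro exI[of _ 0] exI[of _ 1]) (simp add: add.commute)

lemma rel_imp_adjoin: "A \<sim> B \<Longrightarrow> adjoin S T A B"
  unfolding adjoin_def by (intro exI[of _ 0]) simp

lemma adjoin_sym: "adjoin S T A B \<Longrightarrow> adjoin S T B A"
  unfolding adjoin_def by (metis rel_sym)

lemma adjoin_trans:
  assumes "adjoin S T A B" "adjoin S T B C"
  shows "adjoin S T A C"
proof -
  obtain j k j' k' where 1: "A + repeat_mset j S + repeat_mset k T \<sim> B + repeat_mset k S + repeat_mset j T"
    and 2: "B + repeat_mset j' S + repeat_mset k' T \<sim> C + repeat_mset k' S + repeat_mset j' T"
    using assms unfolding adjoin_def by blast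
  \<comment> \<open>The sum of the two relations, arranged so that the middle term \<open>B\<close>
    cancels.\<close>
  have "B + (A + repeat_mset (j + j') S + repeat_mset (k + k') T)
      \<sim> B + (C + repeat_mset (k + k') S + repeat_mset (j + j') T)"
    using rel_add[OF 1 2] by (simp add: repeat_mset_add add_ac)
  then show ?thesis unfolding adjoin_def rel_cancel by blast
qed

lemma adjoin_add_left: "adjoin S T A B \<Longrightarrow> adjoin S T (C + A) (C + B)"
  unfolding adjoin_def by (metis rel_add_left add.assoc)

text \<open>
  If \<open>P\<close> and \<open>Q\<close> differ by a torsion element, every relation identifying them is itself torsion, so
  any respected weight is unable to separate its sides. Otherwise a weight separating \<open>P\<close> from
  \<open>Q\<close> shows that the weight of the relation divides a nonzero integer.
\<close>

lemma adjoin_weight_bound: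
  assumes inf: "\<not> torsion P0 Q0" and PQ: "\<not> P \<sim> Q"
  obtains \<xi> c i j where "\<xi> i \<noteq> \<xi> j" "\<And>S T. adjoin S T P Q \<Longrightarrow> \<bar>weight \<xi> S - weight \<xi> T\<bar> \<le> c"
proof (cases "torsion P Q")
  case True
  then obtain m where m: "m > 0" "repeat_mset m P \<sim> repeat_mset m Q" by (auto simp: torsion_def)
  \<comment> \<open>Every respected weight agrees on \<open>P\<close> and \<open>Q\<close> in this
    case, so a nonzero weight has to come from the pair \<open>P0\<close>,
    \<open>Q0\<close>.\<close>
  obtain \<xi> where \<xi>: "\<And>A B. A \<sim> B \<Longrightarrow> weight \<xi> A = weight \<xi> B" "weight \<xi> P0 \<noteq> weight \<xi> Q0"
    using separating_weight[OF inf] by blast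
  obtain i j where ij: "\<xi> i \<noteq> \<xi> j" using weight_not_constant[OF \<xi>] by blast
  have "\<bar>weight \<xi> S - weight \<xi> T\<bar> \<le> 0" if adj: "adjoin S T P Q" for S T
  proof -
    obtain j k where jk: "P + repeat_mset j S + repeat_mset k T \<sim> Q + repeat_mset k S + repeat_mset j T"
      using adj by (auto simp: adjoin_def)
    have "j \<noteq> k"
    proof
      assume "j = k"
      then have "P + (repeat_mset k S + repeat_mset k T) \<sim> Q + (repeat_mset k S + repeat_mset k T)"
        using jk by (simp add: add_ac)
      then show False using PQ by (simp add: rel_cancel_right)
    qed
    have "int m * weight \<xi> P = int m * weight \<xi> Q" using \<xi>(1)[OF m(2)] by simp
    then have "weight \<xi> P = weight \<xi> Q" using m(1) by simp
    then have "(int j - int k) * (weight \<xi> S - weight \<xi> T) = 0"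
      using \<xi>(1)[OF jk] by (simp add: algebra_simps)
    then show ?thesis using \<open>j \<noteq> k\<close> by simp
  qed
  then show thesis by (rule that[OF ij])
next
  case False
  obtain \<xi> where \<xi>: "\<And>A B. A \<sim> B \<Longrightarrow> weight \<xi> A = weight \<xi> B" "weight \<xi> P \<noteq> weight \<xi> Q"
    using separating_weight[OF False] by blast
  obtain i j where ij: "\<xi> i \<noteq> \<xi> j" using weight_not_constant[OF \<xi>] by blast
  have "\<bar>weight \<xi> S - weight \<xi> T\<bar> \<le> \<bar>weight \<xi> P - weight \<xi> Q\<bar>" if adj: "adjoin S T P Q" for S T
  proof -
    obtain j k where jk: "P + repeat_mset j S + repeat_mset k T \<sim> Q + repeat_mset k S + repeat_mset j T"
      using adj by (auto simp: adjoin_def)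
    have "weight \<xi> P - weight \<xi> Q = (weight \<xi> S - weight \<xi> T) * (int k - int j)"
      using \<xi>(1)[OF jk] by (simp add: algebra_simps)
    then show ?thesis using \<xi>(2) by (intro dvd_imp_le_int) auto
  qed
  then show thesis by (rule that[OF ij])
qed

end

subsection \<open>Presented structures\<close>

lemma word_val_mset:
  assumes M: "commuting_bijections M" and x: "x \<in> universe M" and uv: "mset u = mset v"
  shows "word_val M u x = word_val M v x"
  using uv
proof (induction u arbitrary: v)
  case (Cons i u)
  then have "i \<in> set v" by (metis list.set_intros(1) set_mset_mset)
  then obtain ys zs where v: "v = ys @ i # zs" by (meson split_list)
  have "word_val M v x = word_val M ys (word_val M [i] (word_val M zs x))"
    by (simp add: v word_val_def)
  also have "\<dots> = word_val M [i] (word_val M ys (word_val M zs x))"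
    by (rule word_val_commute[OF M word_val_universe[OF M x]])
  also have "word_val M ys (word_val M zs x) = word_val M u x"
    using Cons.IH[of "ys @ zs"] Cons.prems by (simp add: v word_val_append)
  finally show ?case by (simp add: word_val_def)
qed simp

lemma term_rel_mono: "R \<subseteq> R' \<Longrightarrow> term_rel T R \<subseteq> term_rel T R'"
  unfolding term_rel_def consequence_def by blast

lemma term_rel_append: "(u, v) \<in> term_rel T R \<Longrightarrow> (w @ u, w @ v) \<in> term_rel T R"
  by (induction w) (simp_all add: term_rel_Cons)

lemma term_rel_class: "term_rel T R `` {u} = term_rel T R `` {v} \<longleftrightarrow> (u, v) \<in> term_rel T R"
  using eq_equiv_class_iff[OF equiv_term_rel, of u v T R] by simp

lemma word_val_presented_class:
  "word_val (presented T R) u (term_rel T R `` {w}) = term_rel T R `` {u @ w}"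
  by (induction u) (simp_all add: word_val_def fn_presented)

lemma universe_presented: "universe (presented T R) = range (\<lambda>w. term_rel T R `` {w})"
  by (auto simp: presented_def quotient_def)

text \<open>
  The quotient of the closed terms by \<open>Q\<close> is a homomorphic image of the free structure, hence
  satisfies the equations of the variety.
\<close>

lemma term_rel_least:
  fixes Ax :: "'f::countable fm set" and Q :: "('f list \<times> 'f list) set"
  assumes Ax: "variety_axioms Ax" and T: "T = theory_of Ax"
    and Q: "equiv UNIV Q" and Cons: "\<And>i u v. (u, v) \<in> Q \<Longrightarrow> (i # u, i # v) \<in> Q"
    and free: "term_rel T {} \<subseteq> Q" and R: "R \<subseteq> Q"
  shows "term_rel T R \<subseteq> Q"
proof -
  define M where "M = \<lparr> universe = UNIV // Q, fn = (\<lambda>i X. Q `` ((#) i ` X)) \<rparr>"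
  have cls: "Q `` {u} = Q `` {v} \<longleftrightarrow> (u, v) \<in> Q" for u v
    using eq_equiv_class_iff[OF Q, of u v] by simp
  have refl: "(u, u) \<in> Q" for u using cls by blast
  have fn: "fn M i (Q `` {w}) = Q `` {i # w}" for i w
  proof -
    have "(i # w, y) \<in> Q" if "(w, v) \<in> Q" "(i # v, y) \<in> Q" for v y
      using that Q Cons unfolding equiv_def trans_def by blast
    then have "Q `` ((#) i ` (Q `` {w})) = Q `` {i # w}" using refl[of w] by auto
    then show ?thesis by (simp add: M_def)
  qed
  have word: "word_val M u (Q `` {w}) = Q `` {u @ w}" for u w
    by (induction u) (simp_all add: word_val_def fn)
  have univ: "universe M = range (\<lambda>w. Q `` {w})" by (auto simp: M_def quotient_def)
  have struct: "is_struct M" by (auto simp: is_struct_def univ fn)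
  have sentences: "sentence \<psi>" if "\<psi> \<in> Ax" for \<psi>
    using that Ax by (auto simp: variety_axioms_def universal_equation_def)
  have ax: "M \<Turnstile> \<psi>" if psi: "\<psi> \<in> Ax" for \<psi>
  proof -
    obtain xs s t where st: "\<psi> = foldr Forall xs (Eq s t)"
      using psi Ax by (auto simp: variety_axioms_def universal_equation_def)
    have "\<psi> \<in> theory_of Ax" using psi sentences by (auto simp: theory_of_def entails_def)
    then have eq: "presented T {} \<Turnstile> Eq s t"
      using presented_in_variety[OF Ax] models_foldr_All st unfolding T by blast
    have "sat M \<beta> (Eq s t)" if b: "range \<beta> \<subseteq> universe M" for \<beta>
    proof -
      have "\<forall>x. \<exists>w. \<beta> x = Q `` {w}" using b by (auto simp: univ)
      then obtain \<rho> where \<rho>: "\<And>x. \<beta> x = Q `` {\<rho> x}" by metis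
      \<comment> \<open>The assignment is lifted to the free structure along the representatives
        \<open>\<rho>\<close>; the equation holds there, and \<open>free\<close> carries it to
        \<open>Q\<close>.\<close>
      have "sat (presented T {}) (\<lambda>x. term_rel T {} `` {\<rho> x}) (Eq s t)"
        by (rule eq[unfolded models_def, rule_format]) (auto simp: universe_presented)
      then have "(tword s @ \<rho> (tvar s), tword t @ \<rho> (tvar t)) \<in> term_rel T {}"
        by (simp add: tval_word word_val_presented_class term_rel_class)
      then show ?thesis using free by (auto simp: tval_word \<rho> word cls)
    qed
    then have "M \<Turnstile> Eq s t" by (simp add: models_def)
    then show ?thesis using models_foldr_All st by blast
  qed
  have model: "M \<Turnstile> \<psi>" if psi: "\<psi> \<in> T" for \<psi>
    by (rule entails_any[OF _ sentences _ struct ax]) (use psi in \<open>auto simp: T theory_of_def\<close>)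
  have ident: "sat_ident M (Q `` {[]}) r \<longleftrightarrow> r \<in> Q" for r
    by (cases r) (simp add: sat_ident_def word cls)
  show ?thesis
  proof
    fix r assume "r \<in> term_rel T R"
    then have "consequence T R r" by (auto simp: term_rel_def)
    then have "sat_ident M (Q `` {[]}) r"
      by (rule consequence_any[OF _ _ struct _ model])
        (use R ident in \<open>auto simp: univ T theory_of_def\<close>)
    then show "r \<in> Q" by (simp add: ident)
  qed
qed

section \<open>The group of the variety and its quotients by one relation\<close>

locale commutative_bijective_variety =
  fixes Ax T :: "'f::finite fm set"
  assumes Ax: "variety_axioms Ax" and T: "T = theory_of Ax"
    and bijective: "generalized_bijective T" and commutative: "commutative_theory T"
begin

lemma model_commuting_bijections:
  fixes M :: "('f, 'u) struct"
  assumes M: "is_struct M" and model: "\<And>\<psi>. \<psi> \<in> T \<Longrightarrow> M \<Turnstile> \<psi>"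
  shows "commuting_bijections M"
proof -
  have transfer: "sat M \<beta> \<phi>" if "T \<tturnstile> \<phi>" "sentence \<phi>" "range \<beta> \<subseteq> universe M" for \<phi> \<beta>
    using entails_any[OF that(1) _ that(2) M model] that(3) by (auto simp: T theory_of_def models_def)
  obtain m where "m \<in> universe M" using M by (auto simp: is_struct_def)
  then have range: "range (\<lambda>_::nat. m) \<subseteq> universe M" by auto
  have "sat M (\<lambda>_. m) (Forall 0 (Forall 1 (Imp (Eq (App i (Var 0)) (App i (Var 1))) (Eq (Var 0) (Var 1)))))"
    and "sat M (\<lambda>_. m) (Forall 1 (Exists 0 (Eq (App i (Var 0)) (Var 1))))"
    and "sat M (\<lambda>_. m) (Forall 0 (Eq (App i (App j (Var 0))) (App j (App i (Var 0)))))" for i j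
    using bijective commutative
    by (auto intro!: transfer[OF _ _ range] simp: generalized_bijective_def commutative_theory_def sentence_def simp del: sat.simps)
  then have "\<forall>x \<in> universe M. \<forall>y \<in> universe M. fn M i x = fn M i y \<longrightarrow> x = y"
    and "\<forall>y \<in> universe M. \<exists>x \<in> universe M. fn M i x = y"
    and "\<forall>x \<in> universe M. fn M i (fn M j x) = fn M j (fn M i x)" for i j
    by simp_all
  moreover have "fn M i x \<in> universe M" if "x \<in> universe M" for i x
    using M that by (auto simp: is_struct_def)
  ultimately show ?thesis
    using M unfolding commuting_bijections_def bij_betw_def inj_on_def by (auto simp: image_iff) metis
qed

lemma presented_commuting_bijections: "commuting_bijections (presented T R)"
  using model_commuting_bijections[OF is_struct_presented] presented_in_variety[OF Ax]
  unfolding T by blast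

lemma term_rel_mset:
  assumes "mset u = mset v"
  shows "(u, v) \<in> term_rel T R"
  using word_val_mset[OF presented_commuting_bijections _ assms, of "term_rel T R `` {[]}" R]
  by (auto simp: universe_presented word_val_presented term_rel_class)

text \<open>The existential avoids choosing an order of the symbols; by \<open>term_rel_mset\<close>
  every order gives the same result, which is \<open>free_rel_mset\<close>.\<close>

definition free_rel :: "'f multiset \<Rightarrow> 'f multiset \<Rightarrow> bool" where
  "free_rel A B \<longleftrightarrow> (\<exists>u v. mset u = A \<and> mset v = B \<and> (u, v) \<in> term_rel T {})"

lemma term_rel_sym: "(u, v) \<in> term_rel T R \<Longrightarrow> (v, u) \<in> term_rel T R"
  and term_rel_trans: "(u, v) \<in> term_rel T R \<Longrightarrow> (v, w) \<in> term_rel T R \<Longrightarrow> (u, w) \<in> term_rel T R"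
  using term_rel_class by metis+

lemma free_rel_mset: "free_rel (mset u) (mset v) \<longleftrightarrow> (u, v) \<in> term_rel T {}"
  unfolding free_rel_def using term_rel_mset term_rel_trans by metis

sublocale abelian_group_relation free_rel
proof
  fix A B C :: "'f multiset" and i
  obtain u v w where uvw: "A = mset u" "B = mset v" "C = mset w" by (metis ex_mset)
  show "free_rel A A" unfolding uvw free_rel_mset by (rule term_rel_mset) simp
  show "free_rel B A" if "free_rel A B" using that unfolding uvw free_rel_mset by (rule term_rel_sym)
  show "free_rel A C" if "free_rel A B" "free_rel B C"
    using that unfolding uvw free_rel_mset by (rule term_rel_trans)
  show "free_rel (C + A) (C + B)" if "free_rel A B"
    using that unfolding uvw mset_append[symmetric] free_rel_mset by (rule term_rel_append)
  have "bij_betw (fn (presented T {}) i) (universe (presented T {})) (universe (presented T {}))"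
    using presented_commuting_bijections by (simp add: commuting_bijections_def)
  \<comment> \<open>Surjectivity makes the generator a value of \<open>f_i\<close>, and its preimage
    is the class of a word \<open>x\<close>, which is then the inverse of \<open>i\<close>.\<close>
  then have "term_rel T {} `` {[]} \<in> fn (presented T {}) i ` universe (presented T {})"
    by (auto simp: bij_betw_def universe_presented)
  then obtain x where "term_rel T {} `` {[]} = term_rel T {} `` {i # x}"
    by (auto simp: universe_presented fn_presented)
  then have "free_rel (mset (i # x)) (mset [])"
    unfolding free_rel_mset term_rel_class by (rule term_rel_sym)
  then show "\<exists>A. free_rel (add_mset i A) {#}" by auto
qed

text \<open>\<open>adjoin\<close> is a congruence that contains the free equations and the pair
  \<open>(t, t')\<close>, so \<open>term_rel_least\<close> applies: modulo the free equations, each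
  consequence of the identity is an integer multiple of it.\<close>

lemma term_rel_adjoin:
  assumes "(u, v) \<in> term_rel T {(t, t')}"
  shows "adjoin (mset t) (mset t') (mset u) (mset v)"
proof -
  let ?Q = "{(u, v). adjoin (mset t) (mset t') (mset u) (mset v)}"
  have "term_rel T {(t, t')} \<subseteq> ?Q"
  proof (rule term_rel_least[OF Ax T])
    show "equiv UNIV ?Q"
      by (intro equivI) (auto simp: refl_on_def sym_def trans_def
          intro: rel_imp_adjoin rel_refl adjoin_sym adjoin_trans)
    show "(i # u, i # v) \<in> ?Q" if "(u, v) \<in> ?Q" for i u v
      using that adjoin_add_left[of _ _ _ _ "{#i#}"] by simp
    show "term_rel T {} \<subseteq> ?Q" by (auto simp flip: free_rel_mset intro: rel_imp_adjoin)
    show "{(t, t')} \<subseteq> ?Q" by (simp add: adjoin_generator)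
  qed
  then show ?thesis using assms by blast
qed

text \<open>A point is \<open>w(a)\<close> for some word \<open>w\<close>, and \<open>w\<close> can
  be commuted to the outside and cancelled. Hence all points satisfy the same equations between
  words.\<close>

lemma word_val_presented_eq:
  assumes "x \<in> universe (presented T R)"
  shows "word_val (presented T R) u x = word_val (presented T R) v x \<longleftrightarrow> (u, v) \<in> term_rel T R"
proof -
  let ?a = "term_rel T R `` {[]}" and ?P = "presented T R"
  have a: "?a \<in> universe ?P" by (auto simp: universe_presented)
  obtain w where x: "x = word_val ?P w ?a" using assms presented_generated by blast
  have "word_val ?P u x = word_val ?P v x \<longleftrightarrow>
      word_val ?P w (word_val ?P u ?a) = word_val ?P w (word_val ?P v ?a)"
    unfolding x using word_val_commute[OF presented_commuting_bijections a] by metis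
  also have "\<dots> \<longleftrightarrow> word_val ?P u ?a = word_val ?P v ?a"
    using word_val_inject[OF presented_commuting_bijections]
      word_val_universe[OF presented_commuting_bijections a] by blast
  finally show ?thesis by (simp add: word_val_presented term_rel_class)
qed

lemma agree_presented:
  assumes "\<And>u v. length u \<le> r \<Longrightarrow> length v \<le> r \<Longrightarrow> (u, v) \<in> term_rel T R \<Longrightarrow> (u, v) \<in> term_rel T {}"
  shows "agree r (presented T {}) (presented T R)"
  unfolding agree_def using assms term_rel_mono[of "{}" R T] by (auto simp: word_val_presented_eq)

text \<open>Take \<open>K + 1\<close> words with distinct values in the infinite free structure.
  Agreement up to their greatest length keeps these values apart in the quotient.\<close>

lemma agree_larger_than:
  assumes inf: "infinite (universe (presented T {}))"
  obtains r where "\<And>R. agree r (presented T {}) (presented T R) \<Longrightarrow> larger_than K (presented T R)"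
proof -
  obtain S where S: "finite S" "card S = Suc K" "S \<subseteq> universe (presented T {})"
    using infinite_arbitrarily_large[OF inf] by blast
  then obtain W where W: "inj_on (\<lambda>w. term_rel T {} `` {w}) W" "S = (\<lambda>w. term_rel T {} `` {w}) ` W"
    unfolding universe_presented subset_image_inj by blast
  have card_W: "card W = Suc K" using S(2) W card_image by metis
  then have fin: "finite W" by (metis card.infinite nat.distinct(1))
  obtain r where r: "\<And>w. w \<in> W \<Longrightarrow> length w \<le> r"
    using finite_imageI[OF fin, of length] by (metis finite_nat_set_iff_bounded_le imageI)
  show thesis
  proof (rule that[of r])
    fix R assume agr: "agree r (presented T {}) (presented T R)"
    let ?a = "term_rel T {} `` {[]}" and ?b = "term_rel T R `` {[]}"
    have "u = v" if uv: "u \<in> W" "v \<in> W" and eq: "term_rel T R `` {u} = term_rel T R `` {v}" for u v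
    proof -
      have "?a \<in> universe (presented T {})" "?b \<in> universe (presented T R)"
        by (auto simp: universe_presented)
      then have "word_val (presented T {}) u ?a = word_val (presented T {}) v ?a"
        using agr uv r eq unfolding agree_def by (metis word_val_presented)
      then show ?thesis using W(1) uv by (simp add: word_val_presented inj_on_def)
    qed
    then have "inj_on (\<lambda>w. term_rel T R `` {w}) W" by (simp add: inj_on_def)
    then have "card ((\<lambda>w. term_rel T R `` {w}) ` W) = Suc K" using card_W card_image by metis
    then show "larger_than K (presented T R)"
      using card_mono[of "universe (presented T R)" "(\<lambda>w. term_rel T R `` {w}) ` W"]
      unfolding larger_than_def universe_presented by fastforce
  qed
qed

lemma exists_nontorsion:
  assumes inf: "infinite (universe (presented T {}))"
  obtains i where "\<not> torsion {#i#} {#}"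
proof (rule ccontr)
  assume "\<not> thesis"
  then have "\<And>i. torsion {#i#} {#}" using that by blast
  then obtain K where K: "\<And>A. \<exists>B. size B \<le> K \<and> free_rel A B"
    by (rule torsion_imp_finite_classes) (rule that)
  have "universe (presented T {}) \<subseteq> (\<lambda>w. term_rel T {} `` {w}) ` {w. length w \<le> K}"
  proof
    fix x assume "x \<in> universe (presented T {})"
    then obtain u where u: "x = term_rel T {} `` {u}" by (auto simp: universe_presented)
    obtain B where B: "size B \<le> K" "free_rel (mset u) B" using K by blast
    obtain v where v: "B = mset v" by (metis ex_mset)
    have "x = term_rel T {} `` {v}" using B(2) by (simp add: u v free_rel_mset term_rel_class)
    moreover have "length v \<le> K" using B(1) by (simp add: v)
    ultimately show "x \<in> (\<lambda>w. term_rel T {} `` {w}) ` {w. length w \<le> K}" by blast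
  qed
  then have "finite (universe (presented T {}))"
    by (rule finite_subset) (rule finite_imageI[OF finite_words])
  then show False using inf by contradiction
qed

text \<open>An identity that merges \<open>u\<close> and \<open>v\<close> has a weight difference in
  \<open>{-c..c}\<close>. These are finitely many values, and each is taken on a negligible
  set.\<close>

lemma negligible_identification:
  assumes inf: "infinite (universe (presented T {}))" and uv: "(u, v) \<notin> term_rel T {}"
  shows "negligible {r. (u, v) \<in> term_rel T {r}}"
proof -
  obtain i0 where nontorsion: "\<not> torsion {#i0#} {#}" using exists_nontorsion[OF inf] by blast
  have distinct: "\<not> free_rel (mset u) (mset v)" using uv by (simp add: free_rel_mset)
  obtain \<xi> c i j where ij: "\<xi> i \<noteq> \<xi> j"
    and bound: "\<And>S S'. adjoin S S' (mset u) (mset v) \<Longrightarrow> \<bar>weight \<xi> S - weight \<xi> S'\<bar> \<le> c"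
    by (rule adjoin_weight_bound[OF nontorsion distinct]) (rule that)
  show ?thesis
  proof (rule negligible_subset)
    show "negligible (\<Union>x\<in>{-c..c}. {(t, t'). sum_list (map \<xi> t) - sum_list (map \<xi> t') = x})"
      by (intro negligible_UN negligible_weight_diff[OF ij]) simp
    show "{r. (u, v) \<in> term_rel T {r}} \<subseteq>
        (\<Union>x\<in>{-c..c}. {(t, t'). sum_list (map \<xi> t) - sum_list (map \<xi> t') = x})"
    proof
      fix r assume r: "r \<in> {r. (u, v) \<in> term_rel T {r}}"
      obtain t t' where tt: "r = (t, t')" by force
      have "\<bar>weight \<xi> (mset t) - weight \<xi> (mset t')\<bar> \<le> c"
        by (rule bound[OF term_rel_adjoin]) (use r tt in simp)
      then show "r \<in> (\<Union>x\<in>{-c..c}. {(t, t'). sum_list (map \<xi> t) - sum_list (map \<xi> t') = x})"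
        by (auto simp: tt weight_mset)
    qed
  qed
qed

lemma negligible_falsifying:
  assumes inf: "infinite (universe (presented T {}))"
    and \<phi>: "sentence \<phi>" "presented T {} \<Turnstile> \<phi>"
  shows "negligible {r. \<not> presented T {r} \<Turnstile> \<phi>}"
proof -
  obtain r1 K where transfer: "\<forall>(M :: ('f, 'f list set) struct) (N :: ('f, 'f list set) struct) \<beta> \<gamma>.
    commuting_bijections M \<longrightarrow> commuting_bijections N \<longrightarrow> agree r1 M N \<longrightarrow>
    larger_than K M \<longrightarrow> larger_than K N \<longrightarrow> range \<beta> \<subseteq> universe M \<longrightarrow> range \<gamma> \<subseteq> universe N \<longrightarrow>
    similar r1 (fv \<phi>) M \<beta> N \<gamma> \<longrightarrow> sat M \<beta> \<phi> = sat N \<gamma> \<phi>"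
    using sat_transfer[of \<phi>] by (elim exE) (rule that)
  obtain r2 where r2: "\<And>R. agree r2 (presented T {}) (presented T R) \<Longrightarrow> larger_than K (presented T R)"
    using agree_larger_than[OF inf] by blast
  \<comment> \<open>\<open>r1\<close> serves the transfer of the sentence, \<open>r2\<close> the
    size of the quotient.\<close>
  define r where "r = max r1 r2"
  let ?B = "{(u :: 'f list, v :: 'f list). length u \<le> r \<and> length v \<le> r \<and> (u, v) \<notin> term_rel T {}}"
  have fin: "finite ?B"
    by (rule finite_subset[of _ "{u. length u \<le> r} \<times> {v. length v \<le> r}"]) (auto simp: finite_words)
  have holds: "presented T {q} \<Turnstile> \<phi>" if q: "q \<notin> (\<Union>p\<in>?B. {q. p \<in> term_rel T {q}})" for q
  proof -
    have agr: "agree r (presented T {}) (presented T {q})"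
      by (rule agree_presented) (use q in blast)
    have agrs: "agree r1 (presented T {}) (presented T {q})" "agree r2 (presented T {}) (presented T {q})"
      by (rule agree_mono[OF agr], simp add: r_def)+
    \<comment> \<open>A sentence has no free variables, so any assignment will do and
      \<open>similar\<close> holds vacuously.\<close>
    let ?\<beta> = "\<lambda>R (_ :: nat). term_rel T R `` {[]}"
    have range: "range (?\<beta> R) \<subseteq> universe (presented T R)" for R by (auto simp: universe_presented)
    have "sat (presented T {}) (?\<beta> {}) \<phi> = sat (presented T {q}) (?\<beta> {q}) \<phi>"
    proof (rule transfer[rule_format, OF _ _ agrs(1) _ r2[OF agrs(2)] range range])
      show "larger_than K (presented T {})" using inf by (simp add: larger_than_def)
      show "similar r1 (fv \<phi>) (presented T {}) (?\<beta> {}) (presented T {q}) (?\<beta> {q})"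
        using \<phi>(1) by (simp add: sentence_def similar_def)
    qed (rule presented_commuting_bijections)+
    then show ?thesis using \<phi> models_sentence[OF \<phi>(1) range] by blast
  qed
  have "negligible (\<Union>p\<in>?B. {q. p \<in> term_rel T {q}})"
    using negligible_identification[OF inf] by (intro negligible_UN[OF fin]) auto
  then show ?thesis by (rule negligible_subset) (use holds in blast)
qed

end

section \<open>From exceptional identities to limiting density\<close>

lemma limiting_density_1:
  assumes "negligible {r. \<not> presented T {r} \<Turnstile> \<phi>}" (is "negligible ?B")
  shows "limiting_density T \<phi> 1"
  unfolding limiting_density_def
proof -
  let ?I = "\<lambda>s. idents_upto s :: ('a list \<times> 'a list) set"
  have eq: "real (card {r \<in> ?I s. presented T {r} \<Turnstile> \<phi>}) / real (card (?I s)) =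
      1 - real (card (?B \<inter> ?I s)) / real (card (?I s))" for s
  proof -
    have "([], []) \<in> ?I s" by (simp add: idents_upto_def)
    then have pos: "card (?I s) > 0" using finite_idents_upto[of s, where 'f = 'a] by (auto simp: card_gt_0_iff)
    have "{r \<in> ?I s. presented T {r} \<Turnstile> \<phi>} = ?I s - ?B \<inter> ?I s" by auto
    then have "card {r \<in> ?I s. presented T {r} \<Turnstile> \<phi>} = card (?I s) - card (?B \<inter> ?I s)"
      using card_Diff_subset[of "?B \<inter> ?I s" "?I s"] finite_idents_upto[of s, where 'f = 'a] by simp
    moreover have "card (?B \<inter> ?I s) \<le> card (?I s)" by (simp add: card_mono finite_idents_upto)
    ultimately show ?thesis using pos by (simp add: of_nat_diff field_simps)
  qed
  have "(\<lambda>s. 1 - real (card (?B \<inter> ?I s)) / real (card (?I s))) \<longlonglongrightarrow> 1 - 0"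
    by (rule tendsto_diff[OF tendsto_const assms[unfolded negligible_def]])
  then show "(\<lambda>s. real (card {r \<in> ?I s. presented T {r} \<Turnstile> \<phi>}) / real (card (?I s))) \<longlonglongrightarrow> 1"
    unfolding eq diff_0_right .
qed

theorem theorem4p26:
  fixes Ax T :: "'f::finite fm set"
  assumes "variety_axioms Ax"
    and "T = theory_of Ax"
    and "generalized_bijective T"
    and "commutative_theory T"
    and "infinite (universe (free_struct T))"
  shows "\<forall>\<phi>. sentence \<phi> \<and> free_struct T \<Turnstile> \<phi> \<longrightarrow> limiting_density T \<phi> 1"
proof -
  interpret commutative_bijective_variety Ax T
    by standard (rule assms)+
  show ?thesis
  proof (intro allI impI)
    fix \<phi> assume "sentence \<phi> \<and> free_struct T \<Turnstile> \<phi>"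
    then show "limiting_density T \<phi> 1"
      using assms(5) unfolding free_struct_def
      by (intro limiting_density_1 negligible_falsifying) simp_all
  qed
qed

end
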